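(* Let $K_{n_1,n_2}$ be the complete bipartite graph on $n=n_1+n_2$ vertices with bipartition $(X,Y)$, $|X|=n_1\le n_2=|Y|$. Let $K^+_{n_1,n_2}$ be a graph obtained from $K_{n_1,n_2}$ by adding any $t$ edges ($0\le t\le n_1(n_1-1)/2$) among the vertices of $X$. Then $\alpha(F_k(K^+_{n_1,n_2}))=\alpha(K^+_{n_1,n_2})=n_1$ for all $n_1,n_2$ and all $k=1,\dots,n-1$.
   Context: $\alpha(G)$ denotes the algebraic connectivity of $G$, i.e. the second smallest eigenvalue of its Laplacian matrix. For a graph $G=(V,E)$ on $n$ vertices and $1\le k\le n-1$, the $k$-token graph $F_k(G)$ has as vertices the $k$-subsets of $V$, two $k$-subsets being adjacent iff their symmetric difference is $\{a,b\}$ with $ab\in E$.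
   Formalization: The equality of the algebraic connectivity of K^+ with n_1 is claimed only when (n_1,n_2) is not (1,1), since K_{1,1} has Laplacian spectrum {0,2} and connectivity 2; the equality between the token graph and the graph is stated in all cases. *)

theory Defs
  imports "Jordan_Normal_Form.Char_Poly"
begin

text \<open>A graph is a pair \<open>(V, E)\<close>, the edges being two-element subsets of \<open>V\<close>.\<close>

type_synonym 'v graph = "'v set \<times> 'v set set"

abbreviation verts :: "'v graph \<Rightarrow> 'v set" where "verts G \<equiv> fst G"

abbreviation edges :: "'v graph \<Rightarrow> 'v set set" where "edges G \<equiv> snd G"

definition complete_bipartite :: "'v set \<Rightarrow> 'v set \<Rightarrow> 'v graph" where
  "complete_bipartite X Y = (X \<union> Y, {{x, y} | x y. x \<in> X \<and> y \<in> Y})"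

definition add_edges :: "'v graph \<Rightarrow> 'v set set \<Rightarrow> 'v graph" where
  "add_edges G S = (verts G, edges G \<union> S)"

definition token_graph :: "nat \<Rightarrow> 'v graph \<Rightarrow> 'v set graph" where
  "token_graph k G =
    (let W = {A. A \<subseteq> verts G \<and> card A = k}
     in (W, {{A, B} | A B. A \<in> W \<and> B \<in> W \<and> sym_diff A B \<in> edges G}))"

definition degree_of :: "'v graph \<Rightarrow> 'v \<Rightarrow> nat" where
  "degree_of G v = card {e \<in> edges G. v \<in> e}"

definition laplacian_entry :: "'v graph \<Rightarrow> 'v \<Rightarrow> 'v \<Rightarrow> real" where
  "laplacian_entry G u v =
    (if u = v then real (degree_of G u) else if {u, v} \<in> edges G then - 1 else 0)"

text \<open>Matrices are indexed by natural numbers, so the rows and columns of the Laplacian are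
  labelled through an arbitrary enumeration of the (finite) vertex set.  Another enumeration
  conjugates the matrix by a permutation matrix and leaves the characteristic polynomial,
  hence the eigenvalues, unchanged.\<close>

definition vertex_list :: "'v graph \<Rightarrow> 'v list" where
  "vertex_list G = (SOME vs. distinct vs \<and> set vs = verts G)"

definition laplacian_matrix :: "'v graph \<Rightarrow> real mat" where
  "laplacian_matrix G =
    mat (card (verts G)) (card (verts G))
      (\<lambda>(i, j). laplacian_entry G (vertex_list G ! i) (vertex_list G ! j))"

text \<open>Real eigenvalues in increasing order, repeated according to their multiplicity as roots of
  the characteristic polynomial.  For a symmetric matrix these are all the eigenvalues.\<close>

definition sorted_eigenvalues :: "real mat \<Rightarrow> real list" where
  "sorted_eigenvalues M = sorted_list_of_multiset (proots (char_poly M))"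

text \<open>List positions start at 0.  The value is meaningful only for graphs with at least two
  vertices.\<close>

definition algebraic_connectivity :: "'v graph \<Rightarrow> real" where
  "algebraic_connectivity G = sorted_eigenvalues (laplacian_matrix G) ! 1"

end

theory Submission
  imports Defs
begin

text \<open>A function \<open>f\<close> of mean zero on the \<open>k\<close>-subsets of \<open>V\<close> splits orthogonally, and orthogonally for the
  Dirichlet form, into a lift \<open>A \<mapsto> (\<Sum>v\<in>A. g v)\<close> and a function \<open>h\<close> with
  \<open>(\<Sum>A\<ni>v. h A) = 0\<close> for every vertex \<open>v\<close>. On lifts the Dirichlet form of the token graph is a
  multiple of that of \<open>G\<close>. For \<open>h\<close> one argues by induction on the number of vertices: the restrictions
  of \<open>h\<close> to the \<open>k\<close>-subsets containing, respectively avoiding, \<open>v\<close> have mean zero, so the bound for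
  the complete bipartite graph without \<open>v\<close> applies to both, and averaging over \<open>v \<in> X\<close> (over
  \<open>v \<in> Y\<close> for a star) gives the bound \<open>card X\<close> for \<open>h\<close>. Additional edges only increase the Dirichlet
  form. The value is attained by lifting the difference of the indicators of two vertices of \<open>Y\<close>,
  which has eigenvalue \<open>card X\<close> because edges inside \<open>X\<close> do not affect it; for a single edge there is
  no such pair and the common value is 2.\<close>

section \<open>The second eigenvalue of a symmetric matrix with zero row sums\<close>

lemma char_poly_matrix_index:
  assumes "M \<in> carrier_mat N N" "i < N" "j < N"
  shows "char_poly_matrix M $$ (i, j) = (if i = j then [:0, 1:] else 0) - [:M $$ (i, j):]"
  using assms by (auto simp: char_poly_matrix_def)

text \<open>\<open>B\<close> is \<open>s\<close> times the all-ones column times the first unit row.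
  Zero row sums of \<open>M\<close> give \<open>M * B = 0\<close>, so
  \<open>(x I - M) (x I - B) = x (x I - M - B)\<close>. Taking determinants and cancelling
  \<open>x ^ (N - 1)\<close> gives the identity.\<close>

lemma char_poly_first_column_shift:
  fixes M :: "'a :: field mat" and s :: 'a
  assumes M: "M \<in> carrier_mat N N" and N: "N > 0"
    and row: "\<And>i. i < N \<Longrightarrow> (\<Sum>j<N. M $$ (i, j)) = 0"
  defines "B \<equiv> mat N N (\<lambda>(i, j). if j = 0 then s else 0)"
  shows "char_poly M * [:- s, 1:] = [:0, 1:] * char_poly (M + B)"
proof -
  let ?C = char_poly_matrix
  let ?X = "[:0, 1:] :: 'a poly"
  have B: "B \<in> carrier_mat N N" by (simp add: B_def)
  have MB: "M + B \<in> carrier_mat N N" using M B by simp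
  have CM: "?C M \<in> carrier_mat N N" and CB: "?C B \<in> carrier_mat N N"
    and CMB: "?C (M + B) \<in> carrier_mat N N"
    using M B MB by auto
  have CB_index: "?C B $$ (l, j) = (if l = j then ?X else 0) - (if j = 0 then [:s:] else 0)"
    if "l < N" "j < N" for l j
    using that by (simp add: char_poly_matrix_index[OF B]) (simp add: B_def)
  have MB_index: "(M + B) $$ (i, j) = M $$ (i, j) + (if j = 0 then s else 0)"
    if "i < N" "j < N" for i j
    using that M by (simp add: B_def)
  have "?C M * ?C B = ?X \<cdot>\<^sub>m ?C (M + B)"
  proof (rule eq_matI)
    fix i j assume "i < dim_row (?X \<cdot>\<^sub>m ?C (M + B))" "j < dim_col (?X \<cdot>\<^sub>m ?C (M + B))"
    then have i: "i < N" and j: "j < N" using CMB by auto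
    \<comment> \<open>Zero row sums of \<open>M\<close> enter here: every row of
      \<open>x I - M\<close> sums to \<open>x\<close>.\<close>
    have rowC: "(\<Sum>l<N. ?C M $$ (i, l)) = ?X"
    proof -
      have "(\<Sum>l<N. ?C M $$ (i, l)) = (\<Sum>l<N. (if i = l then ?X else 0) - [:M $$ (i, l):])"
        using char_poly_matrix_index[OF M i] by (intro sum.cong) auto
      also have "\<dots> = ?X - (\<Sum>l<N. [:M $$ (i, l):])"
        using i by (simp add: sum_subtractf)
      also have "(\<Sum>l<N. [:M $$ (i, l):]) = [:\<Sum>l<N. M $$ (i, l):]"
        by (induction N) auto
      finally show ?thesis using row[OF i] by simp
    qed
    have "(?C M * ?C B) $$ (i, j) = (\<Sum>l<N. ?C M $$ (i, l) * ?C B $$ (l, j))"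
      using i j CM CB by (simp add: scalar_prod_def lessThan_atLeast0)
    also have "\<dots> = (\<Sum>l<N. (if l = j then ?C M $$ (i, l) * ?X else 0)
        - (if j = 0 then [:s:] else 0) * ?C M $$ (i, l))"
      using j by (intro sum.cong) (auto simp: CB_index algebra_simps)
    also have "\<dots> = ?C M $$ (i, j) * ?X - (if j = 0 then [:s:] else 0) * (\<Sum>l<N. ?C M $$ (i, l))"
      using j by (simp add: sum_subtractf sum_distrib_left)
    also have "\<dots> = ?X * ?C (M + B) $$ (i, j)"
    proof -
      have "?C (M + B) $$ (i, j) = ?C M $$ (i, j) - (if j = 0 then [:s:] else 0)"
        using i j by (simp add: char_poly_matrix_index[OF M] char_poly_matrix_index[OF MB] MB_index)
      then show ?thesis unfolding rowC by (metis left_diff_distrib mult.commute)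
    qed
    finally show "(?C M * ?C B) $$ (i, j) = (?X \<cdot>\<^sub>m ?C (M + B)) $$ (i, j)"
      using i j CMB by simp
  qed (use CM CB CMB in auto)
  then have "det (?C M) * det (?C B) = ?X ^ N * det (?C (M + B))"
    using det_mult[OF CM CB] CMB by (metis det_smult carrier_matD(2))
  \<comment> \<open>The nonzero entries of \<open>B\<close> lie in its first column, so
    \<open>?C B\<close> is lower triangular with diagonal \<open>x - s, x, ..., x\<close>.\<close>
  moreover have "det (?C B) = [:- s, 1:] * ?X ^ (N - 1)"
  proof -
    have "det (?C B) = prod_list (diag_mat (?C B))"
      by (rule det_lower_triangular[OF _ CB]) (auto simp: CB_index)
    also have "\<dots> = (\<Prod>i<N. ?C B $$ (i, i))"
      using CB by (simp add: prod_list_diag_prod lessThan_atLeast0)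
    also have "\<dots> = (\<Prod>i<N. if i = 0 then [:- s, 1:] else ?X)"
      by (intro prod.cong) (auto simp: CB_index)
    also have "\<dots> = [:- s, 1:] * (\<Prod>i\<in>{..<N} - {0}. ?X)"
      using N by (subst prod.remove[of _ 0]) (auto intro!: prod.cong)
    finally show ?thesis by (simp add: N)
  qed
  moreover have "?X ^ N = ?X * ?X ^ (N - 1)" using N by (metis power_eq_if less_numeral_extra(3))
  ultimately have "?X ^ (N - 1) * (char_poly M * [:- s, 1:])
      = ?X ^ (N - 1) * (?X * char_poly (M + B))"
    unfolding char_poly_def by (simp only: ac_simps)
  then show ?thesis by (subst (asm) mult_cancel_left) simp
qed

text \<open>Eigenvectors become functions on indices, so that later arguments deal with finite sums
  only.\<close>

lemma char_poly_root_iff: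
  fixes M :: "'a :: field mat"
  assumes M: "M \<in> carrier_mat N N"
  shows "poly (char_poly M) c = 0 \<longleftrightarrow>
    (\<exists>w. (\<exists>i<N. w i \<noteq> 0) \<and> (\<forall>i<N. (\<Sum>j<N. M $$ (i, j) * w j) = c * w i))"
proof
  assume "poly (char_poly M) c = 0"
  then obtain v where v: "v \<in> carrier_vec N" "v \<noteq> 0\<^sub>v N" "M *\<^sub>v v = c \<cdot>\<^sub>v v"
    using M by (auto simp: eigenvalue_root_char_poly[OF M, symmetric] eigenvalue_def eigenvector_def)
  have "\<exists>i<N. v $ i \<noteq> 0" using v(1,2) by (metis eq_vecI carrier_vecD index_zero_vec)
  moreover have "(\<Sum>j<N. M $$ (i, j) * v $ j) = c * v $ i" if "i < N" for i
    using arg_cong[OF v(3), of "\<lambda>u. u $ i"] that M v(1)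
    by (simp add: scalar_prod_def lessThan_atLeast0)
  ultimately show "\<exists>w. (\<exists>i<N. w i \<noteq> 0) \<and> (\<forall>i<N. (\<Sum>j<N. M $$ (i, j) * w j) = c * w i)"
    by blast
next
  assume "\<exists>w. (\<exists>i<N. w i \<noteq> 0) \<and> (\<forall>i<N. (\<Sum>j<N. M $$ (i, j) * w j) = c * w i)"
  then obtain w where w: "\<exists>i<N. w i \<noteq> 0" "\<forall>i<N. (\<Sum>j<N. M $$ (i, j) * w j) = c * w i"
    by blast
  have "vec N w \<noteq> 0\<^sub>v N" using w(1) by (metis index_vec index_zero_vec(1))
  moreover have "M *\<^sub>v vec N w = c \<cdot>\<^sub>v vec N w"
    using M w(2) by (intro eq_vecI) (auto simp: scalar_prod_def lessThan_atLeast0)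
  ultimately show "poly (char_poly M) c = 0"
    using M by (auto simp: eigenvalue_root_char_poly[OF M, symmetric] eigenvalue_def eigenvector_def
      intro!: exI[of _ "vec N w"])
qed

text \<open>Write the characteristic polynomial as \<open>x * q\<close>. By the preceding factorisation \<open>(x - s) * q\<close> is
  the characteristic polynomial of a shifted matrix for every \<open>s\<close>, so the roots of \<open>q\<close> are exactly
  the eigenvalues on the complement of the constant vectors, even when \<open>0\<close> is a multiple root.\<close>

lemma second_sorted_eigenvalue:
  fixes M :: "real mat"
  assumes M: "M \<in> carrier_mat N N"
    and sym: "\<And>i j. i < N \<Longrightarrow> j < N \<Longrightarrow> M $$ (i, j) = M $$ (j, i)"
    and row: "\<And>i. i < N \<Longrightarrow> (\<Sum>j<N. M $$ (i, j)) = 0"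
    and gap: "\<And>x. (\<Sum>i<N. x i) = 0 \<Longrightarrow>
      c * (\<Sum>i<N. (x i)\<^sup>2) \<le> (\<Sum>i<N. x i * (\<Sum>j<N. M $$ (i, j) * x j))"
    and g: "(\<Sum>i<N. g i) = 0" "\<exists>i<N. g i \<noteq> 0"
      "\<And>i. i < N \<Longrightarrow> (\<Sum>j<N. M $$ (i, j) * g j) = c * g i"
    and c: "c \<ge> 0"
  shows "sorted_eigenvalues M ! 1 = c"
proof -
  have N: "N > 0" using g(2) by auto
  define B where "B s = mat N N (\<lambda>(i, j). if j = (0::nat) then s else (0::real))" for s
  have MB: "M + B s \<in> carrier_mat N N" for s using M by (simp add: B_def)
  have MBw: "(\<Sum>j<N. (M + B s) $$ (i, j) * w j) = (\<Sum>j<N. M $$ (i, j) * w j) + s * w 0"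
    if "i < N" for s w i
  proof -
    have "(\<Sum>j<N. (M + B s) $$ (i, j) * w j)
        = (\<Sum>j<N. M $$ (i, j) * w j + (if j = 0 then s * w j else 0))"
      using that M by (intro sum.cong) (auto simp: B_def algebra_simps)
    then show ?thesis using N by (simp add: sum.distrib)
  qed
  have "poly (char_poly M) 0 = 0"
    unfolding char_poly_root_iff[OF M] using row N by (intro exI[of _ "\<lambda>_. 1"]) auto
  then obtain q where q: "char_poly M = [:0, 1:] * q"
    by (metis poly_eq_0_iff_dvd dvdE minus_zero)
  have nz: "char_poly M \<noteq> 0" using degree_monic_char_poly[OF M] by auto
  then have qnz: "q \<noteq> 0" using q by auto
  have qB: "char_poly (M + B s) = [:- s, 1:] * q" for s
  proof -
    have "[:0, 1:] * char_poly (M + B s) = [:0, 1:] * ([:- s, 1:] * q)"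
      using char_poly_first_column_shift[OF M N row, of s] unfolding q B_def
      by (simp only: ac_simps)
    then show ?thesis by (subst (asm) mult_cancel_left) simp
  qed
  \<comment> \<open>By symmetry the columns sum to zero too, so every image under \<open>M\<close>
    has mean zero.\<close>
  have colsum: "(\<Sum>i<N. \<Sum>j<N. M $$ (i, j) * w j) = 0" for w
  proof -
    have "(\<Sum>i<N. \<Sum>j<N. M $$ (i, j) * w j) = (\<Sum>j<N. \<Sum>i<N. M $$ (i, j) * w j)"
      by (rule sum.swap)
    also have "\<dots> = (\<Sum>j<N. (\<Sum>i<N. M $$ (j, i)) * w j)"
      using sym by (intro sum.cong) (auto simp: sum_distrib_right)
    also have "\<dots> = 0" using row by simp
    finally show ?thesis .
  qed
  have qc: "poly q c = 0"
  proof -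
    \<comment> \<open>Any \<open>s\<close> other than \<open>c\<close> works: a root
      \<open>c\<close> of \<open>(x - s) * q\<close> is then a root of \<open>q\<close>. The
      constant \<open>m\<close> is chosen so that \<open>g + m\<close> is an eigenvector of
      \<open>M + B s\<close> for \<open>c\<close>.\<close>
    define s where "s = c + 1"
    define m where "m = s * g 0 / (c - s)"
    have m: "s * (g 0 + m) = c * m" by (simp add: m_def s_def field_simps)
    have "\<exists>i<N. g i + m \<noteq> 0"
    proof (rule ccontr)
      assume "\<not> ?thesis"
      then have gm: "\<And>i. i < N \<Longrightarrow> g i = - m" by (simp add: add_eq_0_iff2)
      then have "m = 0" using g(1) N by simp
      then show False using gm g(2) by auto
    qed
    moreover have "(\<Sum>j<N. (M + B s) $$ (i, j) * (g j + m)) = c * (g i + m)" if "i < N" for i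
    proof -
      have "(\<Sum>j<N. M $$ (i, j) * (g j + m)) = c * g i + (\<Sum>j<N. M $$ (i, j)) * m"
        using g(3)[OF that] by (simp add: algebra_simps sum.distrib sum_distrib_left)
      then show ?thesis using m row[OF that] MBw[OF that, of s "\<lambda>j. g j + m"]
        by (simp add: algebra_simps)
    qed
    ultimately have "poly (char_poly (M + B s)) c = 0"
      unfolding char_poly_root_iff[OF MB] by (intro exI[of _ "\<lambda>i. g i + m"]) blast
    then show ?thesis by (simp add: qB s_def algebra_simps)
  qed
  have qge: "c \<le> l" if "poly q l = 0" for l
  proof -
    \<comment> \<open>Any \<open>s\<close> other than \<open>l\<close> works: a constant eigenvector
      of \<open>M + B s\<close> has eigenvalue \<open>s\<close>, so \<open>w\<close> is not constant
      and its centred version \<open>x\<close> is nonzero.\<close>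
    define s where "s = l + 1"
    have "poly (char_poly (M + B s)) l = 0" using that by (simp add: qB)
    then obtain w where w: "\<exists>i<N. w i \<noteq> 0"
      "\<And>i. i < N \<Longrightarrow> (\<Sum>j<N. M $$ (i, j) * w j) + s * w 0 = l * w i"
      unfolding char_poly_root_iff[OF MB] using MBw by auto
    define m where "m = (\<Sum>i<N. w i) / N"
    define x where "x i = w i - m" for i
    \<comment> \<open>Summing the equations for \<open>w\<close> eliminates \<open>M\<close>; the
      result says that subtracting the mean absorbs the shift term \<open>s * w 0\<close>.\<close>
    have "(\<Sum>i<N. (\<Sum>j<N. M $$ (i, j) * w j) + s * w 0) = (\<Sum>i<N. l * w i)"
      using w(2) by (intro sum.cong) auto
    then have "real N * (s * w 0) = l * (\<Sum>i<N. w i)"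
      by (simp add: sum.distrib colsum sum_distrib_left)
    then have m: "s * w 0 = l * m" using N by (simp add: m_def field_simps)
    have x0: "(\<Sum>i<N. x i) = 0" using N by (simp add: x_def m_def sum_subtractf)
    have "(\<Sum>j<N. M $$ (i, j) * x j) = l * x i" if "i < N" for i
    proof -
      have "(\<Sum>j<N. M $$ (i, j) * x j) = (\<Sum>j<N. M $$ (i, j) * w j) - (\<Sum>j<N. M $$ (i, j)) * m"
        by (simp add: x_def algebra_simps sum_subtractf sum_distrib_left)
      then show ?thesis using w(2)[OF that] row[OF that] m by (simp add: x_def algebra_simps)
    qed
    then have "(\<Sum>i<N. x i * (\<Sum>j<N. M $$ (i, j) * x j)) = l * (\<Sum>i<N. (x i)\<^sup>2)"
      by (simp add: sum_distrib_left power2_eq_square ac_simps)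
    then have le: "c * (\<Sum>i<N. (x i)\<^sup>2) \<le> l * (\<Sum>i<N. (x i)\<^sup>2)" using gap[OF x0] by simp
    have "\<exists>i<N. x i \<noteq> 0"
    proof (rule ccontr)
      assume "\<not> ?thesis"
      then have wm: "\<And>i. i < N \<Longrightarrow> w i = m" by (simp add: x_def)
      then have "m = 0" using m wm[OF N] by (simp add: s_def algebra_simps)
      then show False using wm w(1) by auto
    qed
    then have "(\<Sum>i<N. (x i)\<^sup>2) > 0" by (auto intro!: sum_pos2)
    then show ?thesis using le by simp
  qed
  define L where "L = sorted_list_of_multiset (proots q)"
  have Lset: "set L = {l. poly q l = 0}" using qnz by (simp add: L_def)
  have sL: "sorted L" by (simp add: L_def)
  \<comment> \<open>All roots of \<open>q\<close> are at least \<open>c \<ge> 0\<close>, so the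
    extra root 0 sorts to the front and position 1 holds the least root of \<open>q\<close>.\<close>
  have "proots (char_poly M) = add_mset 0 (proots q)"
    using qnz by (simp add: q proots_mult del: mult_pCons_left)
  then have "sorted_eigenvalues M = insort 0 L"
    by (simp add: sorted_eigenvalues_def L_def)
  also have "\<dots> = 0 # L"
    using Lset qge c by (intro insort_is_Cons) force
  finally have "sorted_eigenvalues M ! 1 = hd L"
    using Lset qc by (metis One_nat_def nth_Cons_Suc hd_conv_nth empty_iff list.set(1) mem_Collect_eq)
  also have "hd L = c"
  proof (cases L)
    case Nil
    then show ?thesis using Lset qc by auto
  next
    case (Cons a L')
    have "a \<in> set L" and "c \<in> set L" using Cons Lset qc by auto
    then show ?thesis using sL Cons qge Lset by fastforce
  qed
  finally show ?thesis .
qed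

section \<open>Laplacians of graphs\<close>

lemma card_neighbours_eq_degree:
  assumes simple: "\<forall>e\<in>edges G. e \<subseteq> verts G \<and> card e = 2"
  shows "degree_of G u = card {v \<in> verts G. {u, v} \<in> edges G}"
proof -
  have "bij_betw (\<lambda>v. {u, v}) {v \<in> verts G. {u, v} \<in> edges G} {e \<in> edges G. u \<in> e}"
    unfolding bij_betw_def
  proof
    show "inj_on (\<lambda>v. {u, v}) {v \<in> verts G. {u, v} \<in> edges G}"
      by (auto simp: inj_on_def doubleton_eq_iff)
    have "\<exists>v\<in>verts G. e = {u, v}" if "e \<in> edges G" "u \<in> e" for e
    proof -
      from simple that(1) obtain p q where "e = {p, q}" by (metis card_2_iff)
      then show ?thesis using simple that by (metis doubleton_eq_iff insert_iff singletonD subsetD)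
    qed
    then show "(\<lambda>v. {u, v}) ` {v \<in> verts G. {u, v} \<in> edges G} = {e \<in> edges G. u \<in> e}"
      by (fastforce simp: image_iff)
  qed
  then show ?thesis unfolding degree_of_def by (simp add: bij_betw_same_card)
qed

lemma laplacian_entry_sum:
  assumes fin: "finite (verts G)" and simple: "\<forall>e\<in>edges G. e \<subseteq> verts G \<and> card e = 2"
    and u: "u \<in> verts G"
  shows "(\<Sum>v\<in>verts G. laplacian_entry G u v * f v)
    = (\<Sum>v | v \<in> verts G \<and> {u, v} \<in> edges G. f u - f v)"
proof -
  have loop: "{u, u} \<notin> edges G" using simple by force
  have "(\<Sum>v\<in>verts G. laplacian_entry G u v * f v)
      = (\<Sum>v\<in>verts G. (if v = u then real (degree_of G u) * f v else 0)
          - (if {u, v} \<in> edges G then f v else 0))"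
    using loop by (intro sum.cong) (auto simp: laplacian_entry_def)
  also have "\<dots> = real (degree_of G u) * f u - (\<Sum>v | v \<in> verts G \<and> {u, v} \<in> edges G. f v)"
    using fin u by (simp add: sum_subtractf sum.inter_filter)
  finally show ?thesis
    by (simp add: sum_subtractf card_neighbours_eq_degree[OF simple])
qed

lemma sum_neighbours_commute:
  assumes "finite V"
  shows "(\<Sum>u\<in>V. \<Sum>v | v \<in> V \<and> {u, v} \<in> E. F u v) = (\<Sum>u\<in>V. \<Sum>v | v \<in> V \<and> {u, v} \<in> E. F v u)"
  using sum.swap_restrict[OF assms assms, of F "\<lambda>u v. {u, v} \<in> E"]
  by (simp add: insert_commute)

text \<open>The right-hand side counts each edge in both directions, hence the factor 2. The square
  splits as \<open>f u * (f u - f v) + f v * (f v - f u)\<close>, and both halves have the same sum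
  after exchanging \<open>u\<close> and \<open>v\<close>.\<close>

lemma dirichlet_form:
  fixes f :: "'v \<Rightarrow> real"
  assumes "finite V"
  shows "2 * (\<Sum>u\<in>V. f u * (\<Sum>v | v \<in> V \<and> {u, v} \<in> E. f u - f v))
    = (\<Sum>u\<in>V. \<Sum>v | v \<in> V \<and> {u, v} \<in> E. (f u - f v)\<^sup>2)"
proof -
  have "(\<Sum>u\<in>V. \<Sum>v | v \<in> V \<and> {u, v} \<in> E. (f u - f v)\<^sup>2)
     = (\<Sum>u\<in>V. \<Sum>v | v \<in> V \<and> {u, v} \<in> E. f u * (f u - f v))
       + (\<Sum>u\<in>V. \<Sum>v | v \<in> V \<and> {u, v} \<in> E. f v * (f v - f u))"
    by (simp add: sum.distrib[symmetric] power2_eq_square algebra_simps)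
  also have "(\<Sum>u\<in>V. \<Sum>v | v \<in> V \<and> {u, v} \<in> E. f v * (f v - f u))
      = (\<Sum>u\<in>V. \<Sum>v | v \<in> V \<and> {u, v} \<in> E. f u * (f u - f v))"
    by (rule sum_neighbours_commute[OF assms])
  finally show ?thesis by (simp add: sum_distrib_left)
qed

text \<open>A certificate free of matrices and enumerations: a gap on functions of mean zero
  together with an eigenfunction attaining it.\<close>

lemma algebraic_connectivity_eqI:
  assumes fin: "finite (verts G)" and simple: "\<forall>e\<in>edges G. e \<subseteq> verts G \<and> card e = 2"
    and gap: "\<And>f. (\<Sum>v\<in>verts G. f v) = 0 \<Longrightarrow> 2 * c * (\<Sum>v\<in>verts G. (f v)\<^sup>2)
      \<le> (\<Sum>u\<in>verts G. \<Sum>v | v \<in> verts G \<and> {u, v} \<in> edges G. (f u - f v)\<^sup>2)"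
    and g: "(\<Sum>v\<in>verts G. g v) = 0" "\<exists>v\<in>verts G. g v \<noteq> 0"
      "\<And>u. u \<in> verts G \<Longrightarrow> (\<Sum>v | v \<in> verts G \<and> {u, v} \<in> edges G. g u - g v) = c * g u"
    and c: "c \<ge> 0"
  shows "algebraic_connectivity G = c"
proof -
  define vs where "vs = vertex_list G"
  define N where "N = card (verts G)"
  have "\<exists>vs. distinct vs \<and> set vs = verts G" using finite_distinct_list[OF fin] by blast
  then have vs: "distinct vs" "set vs = verts G"
    unfolding vs_def vertex_list_def by (metis (mono_tags, lifting) someI_ex)+
  then have len: "length vs = N" by (metis N_def distinct_card)
  have bij: "bij_betw (nth vs) {..<N} (verts G)"
    using vs len by (simp add: bij_betw_nth)
  have reindex: "(\<Sum>i<N. F (vs ! i)) = (\<Sum>v\<in>verts G. F v)" for F :: "'a \<Rightarrow> real"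
    by (rule sum.reindex_bij_betw[OF bij])
  have inV: "vs ! i \<in> verts G" if "i < N" for i using that vs len by (metis nth_mem)
  define M where "M = laplacian_matrix G"
  have M: "M \<in> carrier_mat N N" by (simp add: M_def laplacian_matrix_def N_def)
  have ent: "M $$ (i, j) = laplacian_entry G (vs ! i) (vs ! j)" if "i < N" "j < N" for i j
    using that by (simp add: M_def laplacian_matrix_def N_def vs_def)
  have row: "(\<Sum>j<N. M $$ (i, j) * f (vs ! j))
      = (\<Sum>v | v \<in> verts G \<and> {vs ! i, v} \<in> edges G. f (vs ! i) - f v)" if "i < N" for i f
  proof -
    have "(\<Sum>j<N. M $$ (i, j) * f (vs ! j)) = (\<Sum>j<N. laplacian_entry G (vs ! i) (vs ! j) * f (vs ! j))"
      using ent[OF that] by (intro sum.cong) auto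
    also have "\<dots> = (\<Sum>v\<in>verts G. laplacian_entry G (vs ! i) v * f v)"
      by (rule reindex)
    finally show ?thesis using laplacian_entry_sum[OF fin simple inV[OF that]] by simp
  qed
  have "sorted_eigenvalues M ! 1 = c"
  proof (rule second_sorted_eigenvalue[OF M, where g = "\<lambda>i. g (vs ! i)"])
    show "M $$ (i, j) = M $$ (j, i)" if "i < N" "j < N" for i j
      using that by (auto simp: ent laplacian_entry_def insert_commute)
    show "(\<Sum>j<N. M $$ (i, j)) = 0" if "i < N" for i
      using row[OF that, of "\<lambda>_. 1"] by simp
    show "(\<Sum>i<N. g (vs ! i)) = 0" using g(1) by (simp add: reindex)
    show "\<exists>i<N. g (vs ! i) \<noteq> 0" using g(2) vs len by (metis in_set_conv_nth)
    show "(\<Sum>j<N. M $$ (i, j) * g (vs ! j)) = c * g (vs ! i)" if "i < N" for i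
      using row[OF that] g(3)[OF inV[OF that]] by simp
    fix x :: "nat \<Rightarrow> real"
    assume x: "(\<Sum>i<N. x i) = 0"
    \<comment> \<open>An index vector is carried back to the vertices through the inverse of the
      enumeration.\<close>
    define f where "f v = x (inv_into {..<N} (nth vs) v)" for v
    have f: "x i = f (vs ! i)" if "i < N" for i
      using that bij by (simp add: f_def bij_betw_def)
    have "(\<Sum>i<N. x i) = (\<Sum>i<N. f (vs ! i))" using f by simp
    then have "(\<Sum>v\<in>verts G. f v) = 0" using x by (simp add: reindex)
    then have "2 * c * (\<Sum>v\<in>verts G. (f v)\<^sup>2)
       \<le> 2 * (\<Sum>u\<in>verts G. f u * (\<Sum>v | v \<in> verts G \<and> {u, v} \<in> edges G. f u - f v))"
      unfolding dirichlet_form[OF fin] by (rule gap)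
    moreover have "(\<Sum>i<N. (x i)\<^sup>2) = (\<Sum>v\<in>verts G. (f v)\<^sup>2)"
      using reindex[of "\<lambda>v. (f v)\<^sup>2"] f by simp
    moreover have "(\<Sum>i<N. x i * (\<Sum>j<N. M $$ (i, j) * x j))
        = (\<Sum>u\<in>verts G. f u * (\<Sum>v | v \<in> verts G \<and> {u, v} \<in> edges G. f u - f v))"
    proof -
      have "(\<Sum>i<N. x i * (\<Sum>j<N. M $$ (i, j) * x j))
          = (\<Sum>i<N. f (vs ! i) * (\<Sum>j<N. M $$ (i, j) * f (vs ! j)))"
        using f by simp
      also have "\<dots> = (\<Sum>i<N. f (vs ! i)
          * (\<Sum>v | v \<in> verts G \<and> {vs ! i, v} \<in> edges G. f (vs ! i) - f v))"
        using row by simp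
      also have "\<dots> = (\<Sum>u\<in>verts G. f u * (\<Sum>v | v \<in> verts G \<and> {u, v} \<in> edges G. f u - f v))"
        by (rule reindex)
      finally show ?thesis .
    qed
    ultimately show "c * (\<Sum>i<N. (x i)\<^sup>2) \<le> (\<Sum>i<N. x i * (\<Sum>j<N. M $$ (i, j) * x j))"
      by simp
  qed (rule c)
  then show ?thesis by (simp add: algebraic_connectivity_def M_def)
qed

section \<open>Functions on the subsets of fixed size\<close>

definition ksubsets :: "'v set \<Rightarrow> nat \<Rightarrow> 'v set set" where
  "ksubsets V k = {A. A \<subseteq> V \<and> card A = k}"

text \<open>This moves a token between \<open>x\<close> and \<open>y\<close> if exactly one of them
  is occupied and fixes \<open>A\<close> otherwise. As a transposition it is an involution on all
  subsets, so sums can be reindexed by it.\<close>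

abbreviation swap :: "'v \<Rightarrow> 'v \<Rightarrow> 'v set \<Rightarrow> 'v set" where
  "swap x y A \<equiv> Transposition.transpose x y ` A"

text \<open>The adjoint of the lift that sends \<open>g\<close> to
  \<open>\<lambda>A. sum g A\<close>.\<close>

definition down :: "'v set \<Rightarrow> nat \<Rightarrow> ('v set \<Rightarrow> real) \<Rightarrow> 'v \<Rightarrow> real" where
  "down V k f v = (\<Sum>A\<in>ksubsets V k. of_bool (v \<in> A) * f A)"

text \<open>For disjoint \<open>X\<close> and \<open>Y\<close> inside \<open>V\<close> this is twice
  the Dirichlet form of the token graph of the complete bipartite graph, each edge being met from
  both ends. Vertices of \<open>V\<close> outside \<open>X \<union> Y\<close> are isolated, which
  allows vertices to be deleted in two stages.\<close>

definition energy :: "'v set \<Rightarrow> 'v set \<Rightarrow> 'v set \<Rightarrow> nat \<Rightarrow> ('v set \<Rightarrow> real) \<Rightarrow> real" where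
  "energy V X Y k f = (\<Sum>x\<in>X. \<Sum>y\<in>Y. \<Sum>A\<in>ksubsets V k. (f A - f (swap x y A))\<^sup>2)"

lemma finite_ksubsets: "finite V \<Longrightarrow> finite (ksubsets V k)"
  by (auto simp: ksubsets_def)

lemma energy_nonneg: "energy V X Y k f \<ge> 0"
  by (simp add: energy_def sum_nonneg)

lemma energy_commute: "energy V X Y k f = energy V Y X k f"
  unfolding energy_def by (subst sum.swap) (simp add: transpose_commute)

lemma swap_swap: "swap x y (swap x y A) = A"
  by (simp add: image_image)

lemma mem_swap: "v \<in> swap x y A \<longleftrightarrow> Transposition.transpose x y v \<in> A"
  by (metis image_iff transpose_involutory)

lemma swap_mem_ksubsets:
  assumes "x \<in> V" "y \<in> V" "A \<in> ksubsets V k"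
  shows "swap x y A \<in> ksubsets V k"
proof -
  have "swap x y A \<subseteq> V" using assms by (auto simp: ksubsets_def Transposition.transpose_def)
  then show ?thesis using assms by (simp add: ksubsets_def card_image)
qed

lemma sum_ksubsets_swap:
  assumes "x \<in> V" "y \<in> V"
  shows "(\<Sum>A\<in>ksubsets V k. F (swap x y A)) = (\<Sum>A\<in>ksubsets V k. F A)"
  by (rule sum.reindex_bij_witness[of _ "swap x y" "swap x y"])
    (auto simp: swap_swap intro: swap_mem_ksubsets[OF assms])

text \<open>Only the terms at \<open>x\<close> and \<open>y\<close> can change. Differences of a
  lift along token moves thus reduce to differences of \<open>g\<close> along edges.\<close>

lemma sum_minus_sum_swap:
  fixes g :: "'v \<Rightarrow> real"
  assumes "finite A"
  shows "sum g A - sum g (swap x y A) = (g x - g y) * (of_bool (x \<in> A) - of_bool (y \<in> A))"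
proof -
  have "sum g (swap x y A) = (\<Sum>v\<in>A. g (Transposition.transpose x y v))"
    by (simp add: sum.reindex)
  then have "sum g A - sum g (swap x y A) = (\<Sum>v\<in>A. g v - g (Transposition.transpose x y v))"
    by (simp add: sum_subtractf)
  also have "\<dots> = (\<Sum>v\<in>A. (if v = x then g x - g y else 0) - (if v = y then g x - g y else 0))"
    by (intro sum.cong) (auto simp: Transposition.transpose_def)
  also have "\<dots> = (g x - g y) * (of_bool (x \<in> A) - of_bool (y \<in> A))"
    using assms by (simp add: sum_subtractf)
  finally show ?thesis .
qed

section \<open>Lifts of vertex functions and their adjoint\<close>

lemma sum_eq_of_bool_sum:
  fixes g :: "'v \<Rightarrow> real"
  assumes "finite V" "A \<subseteq> V"
  shows "sum g A = (\<Sum>v\<in>V. of_bool (v \<in> A) * g v)"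
proof -
  have "sum g A = (\<Sum>v\<in>V. if v \<in> A then g v else 0)"
    using assms by (simp add: sum.If_cases Int_absorb1)
  also have "\<dots> = (\<Sum>v\<in>V. of_bool (v \<in> A) * g v)"
    by (intro sum.cong) auto
  finally show ?thesis .
qed

lemma lift_down_adjoint:
  fixes g :: "'v \<Rightarrow> real"
  assumes "finite V"
  shows "(\<Sum>A\<in>ksubsets V k. sum g A * f A) = (\<Sum>v\<in>V. g v * down V k f v)"
proof -
  have "(\<Sum>A\<in>ksubsets V k. sum g A * f A)
      = (\<Sum>A\<in>ksubsets V k. \<Sum>v\<in>V. of_bool (v \<in> A) * g v * f A)"
  proof (rule sum.cong[OF refl])
    fix A assume "A \<in> ksubsets V k"
    then have "sum g A = (\<Sum>v\<in>V. of_bool (v \<in> A) * g v)"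
      by (intro sum_eq_of_bool_sum[OF assms]) (simp add: ksubsets_def)
    then show "sum g A * f A = (\<Sum>v\<in>V. of_bool (v \<in> A) * g v * f A)"
      by (simp only: sum_distrib_right)
  qed
  also have "\<dots> = (\<Sum>v\<in>V. \<Sum>A\<in>ksubsets V k. of_bool (v \<in> A) * g v * f A)"
    by (rule sum.swap)
  finally show ?thesis by (simp add: down_def sum_distrib_left ac_simps)
qed

text \<open>Adjointness applied to the constant 1, whose lift is the constant
  \<open>k\<close>.\<close>

lemma sum_down:
  assumes "finite V"
  shows "(\<Sum>v\<in>V. down V k f v) = real k * (\<Sum>A\<in>ksubsets V k. f A)"
proof -
  have "(\<Sum>v\<in>V. down V k f v) = (\<Sum>A\<in>ksubsets V k. (\<Sum>v\<in>A. 1) * f A)"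
    using lift_down_adjoint[OF assms, where g = "\<lambda>_. 1"] by simp
  also have "\<dots> = (\<Sum>A\<in>ksubsets V k. real k * f A)"
    by (intro sum.cong) (auto simp: ksubsets_def)
  finally show ?thesis by (simp add: sum_distrib_left)
qed

lemma sum_ksubsets_remove:
  assumes fin: "finite V" and v: "v \<in> V"
  shows "(\<Sum>A\<in>ksubsets V (Suc j). F A)
    = (\<Sum>A\<in>ksubsets (V - {v}) (Suc j). F A) + (\<Sum>A\<in>ksubsets (V - {v}) j. F (insert v A))"
proof -
  have eq: "ksubsets V (Suc j) = ksubsets (V - {v}) (Suc j) \<union> insert v ` ksubsets (V - {v}) j"
  proof (intro equalityI subsetI)
    fix A assume A: "A \<in> ksubsets V (Suc j)"
    show "A \<in> ksubsets (V - {v}) (Suc j) \<union> insert v ` ksubsets (V - {v}) j"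
    proof (cases "v \<in> A")
      case True
      then have "A = insert v (A - {v})" "A - {v} \<in> ksubsets (V - {v}) j"
        using A by (auto simp: ksubsets_def)
      then show ?thesis by blast
    qed (use A in \<open>auto simp: ksubsets_def\<close>)
  next
    fix A assume "A \<in> ksubsets (V - {v}) (Suc j) \<union> insert v ` ksubsets (V - {v}) j"
    moreover have "card (insert v B) = Suc (card B)" if "B \<subseteq> V - {v}" for B
      using that fin by (intro card_insert_disjoint) (auto dest: finite_subset)
    ultimately show "A \<in> ksubsets V (Suc j)" using v by (auto simp: ksubsets_def)
  qed
  have inj: "inj_on (insert v) (ksubsets (V - {v}) j)"
    unfolding inj_on_def ksubsets_def by (auto simp: insert_ident)
  have "(\<Sum>A\<in>ksubsets V (Suc j). F A)
      = (\<Sum>A\<in>ksubsets (V - {v}) (Suc j). F A) + (\<Sum>A\<in>insert v ` ksubsets (V - {v}) j. F A)"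
    unfolding eq using fin by (intro sum.union_disjoint) (auto simp: finite_ksubsets ksubsets_def)
  then show ?thesis using inj by (simp add: sum.reindex)
qed

text \<open>Deleting \<open>v\<close> from such a set leaves an arbitrary \<open>j\<close>-subset of
  the other \<open>card V - 2\<close> vertices.\<close>

lemma separating_ksubsets_count:
  assumes fin: "finite V" and u: "u \<in> V" and v: "v \<in> V" and uv: "u \<noteq> v"
  shows "(\<Sum>A\<in>ksubsets V (Suc j). of_bool (v \<in> A) * (1 - of_bool (u \<in> A)))
    = real ((card V - 2) choose j)"
proof -
  have "(\<Sum>A\<in>ksubsets V (Suc j). of_bool (v \<in> A) * (1 - of_bool (u \<in> A)))
      = (\<Sum>A\<in>ksubsets (V - {v}) (Suc j). 0)
        + (\<Sum>A\<in>ksubsets (V - {v}) j. of_bool (u \<notin> A) :: real)"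
    unfolding sum_ksubsets_remove[OF fin v] using uv
    by (intro arg_cong2[where f = "(+)"] sum.cong) (auto simp: ksubsets_def)
  also have "\<dots> = real (card {A \<in> ksubsets (V - {v}) j. u \<notin> A})"
    using fin by (simp add: finite_ksubsets Int_def sum_of_bool_eq)
  also have "{A \<in> ksubsets (V - {v}) j. u \<notin> A} = {A. A \<subseteq> V - {v} - {u} \<and> card A = j}"
    by (auto simp: ksubsets_def)
  also have "card \<dots> = (card V - 2) choose j"
    using fin u v uv by (subst n_subsets) (auto simp: numeral_2_eq_2)
  finally show ?thesis .
qed

text \<open>With \<open>a\<close> the number of sets containing \<open>v\<close> and
  \<open>c\<close> the binomial coefficient, \<open>a - c\<close> of them contain a given
  \<open>u \<noteq> v\<close>. So \<open>down\<close> after lifting is \<open>c\<close> times the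
  identity plus \<open>a - c\<close> times the all-ones matrix, which annihilates
  \<open>g\<close>.\<close>

lemma down_lift:
  fixes g :: "'v \<Rightarrow> real"
  assumes fin: "finite V" and g: "sum g V = 0" and v: "v \<in> V"
  shows "down V (Suc j) (\<lambda>A. sum g A) v = real ((card V - 2) choose j) * g v"
proof -
  let ?W = "ksubsets V (Suc j)"
  let ?c = "real ((card V - 2) choose j)"
  define a where "a = (\<Sum>A\<in>?W. of_bool (v \<in> A) :: real)"
  have "down V (Suc j) (\<lambda>A. sum g A) v
      = (\<Sum>A\<in>?W. \<Sum>u\<in>V. of_bool (v \<in> A) * (of_bool (u \<in> A) * g u))"
    unfolding down_def
  proof (rule sum.cong[OF refl])
    fix A assume "A \<in> ?W"
    then have "sum g A = (\<Sum>u\<in>V. of_bool (u \<in> A) * g u)"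
      by (intro sum_eq_of_bool_sum[OF fin]) (simp add: ksubsets_def)
    then show "of_bool (v \<in> A) * sum g A = (\<Sum>u\<in>V. of_bool (v \<in> A) * (of_bool (u \<in> A) * g u))"
      by (simp only: sum_distrib_left)
  qed
  also have "\<dots> = (\<Sum>u\<in>V. g u * (\<Sum>A\<in>?W. of_bool (v \<in> A) * of_bool (u \<in> A)))"
    by (subst sum.swap) (simp add: sum_distrib_left ac_simps)
  also have "\<dots> = (\<Sum>u\<in>V. (a - ?c) * g u + (if u = v then ?c * g u else 0))"
  proof (intro sum.cong refl)
    fix u assume u: "u \<in> V"
    have "(\<Sum>A\<in>?W. of_bool (v \<in> A) * of_bool (u \<in> A))
        = a - (\<Sum>A\<in>?W. of_bool (v \<in> A) * (1 - of_bool (u \<in> A)))"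
      by (simp add: a_def algebra_simps sum_subtractf)
    also have "\<dots> = a - (if u = v then 0 else ?c)"
    proof (cases "u = v")
      case True
      then have "(\<Sum>A\<in>?W. of_bool (v \<in> A) * (1 - of_bool (u \<in> A)) :: real) = 0"
        by (intro sum.neutral) auto
      then show ?thesis using True by simp
    qed (use separating_ksubsets_count[OF fin u v] in simp)
    finally have eq: "(\<Sum>A\<in>?W. of_bool (v \<in> A) * of_bool (u \<in> A)) = a - (if u = v then 0 else ?c)" .
    show "g u * (\<Sum>A\<in>?W. of_bool (v \<in> A) * of_bool (u \<in> A))
        = (a - ?c) * g u + (if u = v then ?c * g u else 0)"
      unfolding eq by (simp add: algebra_simps)
  qed
  also have "\<dots> = (a - ?c) * sum g V + ?c * g v"
    using fin v by (simp add: sum.distrib sum_distrib_left)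
  finally show ?thesis using g by simp
qed

lemma sum_lift_eq_0:
  fixes g :: "'v \<Rightarrow> real"
  assumes fin: "finite V" and g: "sum g V = 0"
  shows "(\<Sum>A\<in>ksubsets V (Suc j). sum g A) = 0"
proof -
  have "real (Suc j) * (\<Sum>A\<in>ksubsets V (Suc j). sum g A) = 0"
    unfolding sum_down[OF fin, symmetric] using down_lift[OF fin g] g
    by (simp add: sum_distrib_left[symmetric])
  then show ?thesis by (simp only: mult_eq_0_iff) simp
qed

lemma sum_lift_squared:
  fixes g :: "'v \<Rightarrow> real"
  assumes fin: "finite V" and g: "sum g V = 0"
  shows "(\<Sum>A\<in>ksubsets V (Suc j). (sum g A)\<^sup>2)
    = real ((card V - 2) choose j) * (\<Sum>v\<in>V. (g v)\<^sup>2)"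
proof -
  let ?c = "real ((card V - 2) choose j)"
  have "(\<Sum>A\<in>ksubsets V (Suc j). (sum g A)\<^sup>2) = (\<Sum>v\<in>V. g v * down V (Suc j) (\<lambda>A. sum g A) v)"
    unfolding power2_eq_square by (rule lift_down_adjoint[OF fin])
  also have "\<dots> = (\<Sum>v\<in>V. ?c * (g v)\<^sup>2)"
    using down_lift[OF fin g] by (intro sum.cong) (auto simp: power2_eq_square)
  finally show ?thesis by (simp add: sum_distrib_left)
qed

text \<open>Neither the norm nor the energy has a cross term between the lift of \<open>g\<close>
  and \<open>h\<close>, and both forms scale by the same \<open>c\<close> on lifts. The hypotheses
  \<open>D\<close> and \<open>H\<close> therefore add up.\<close>

lemma energy_gap_of_orthogonal_parts:
  assumes fin: "finite V" and X: "X \<subseteq> V" and Y: "Y \<subseteq> V" and disj: "X \<inter> Y = {}"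
    and j: "Suc j < card V"
    and D: "\<And>g. sum g V = 0 \<Longrightarrow> m * (\<Sum>v\<in>V. (g v)\<^sup>2) \<le> (\<Sum>x\<in>X. \<Sum>y\<in>Y. (g x - g y)\<^sup>2)"
    and H: "\<And>h. (\<And>v. v \<in> V \<Longrightarrow> down V (Suc j) h v = 0) \<Longrightarrow>
      2 * m * (\<Sum>A\<in>ksubsets V (Suc j). (h A)\<^sup>2) \<le> energy V X Y (Suc j) h"
    and f: "(\<Sum>A\<in>ksubsets V (Suc j). f A) = 0"
  shows "2 * m * (\<Sum>A\<in>ksubsets V (Suc j). (f A)\<^sup>2) \<le> energy V X Y (Suc j) f"
proof -
  let ?W = "ksubsets V (Suc j)"
  define c where "c = real ((card V - 2) choose j)"
  \<comment> \<open>\<open>Suc j < card V\<close> means \<open>j \<le> card V - 2\<close>, so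
    division by \<open>c\<close> is legitimate; \<open>g\<close> is then scaled so that its lift has
    the same image under \<open>down\<close> as \<open>f\<close>.\<close>
  have c: "c > 0" using j by (simp add: c_def)
  define g where "g = (\<lambda>v. down V (Suc j) f v / c)"
  have g0: "sum g V = 0"
    using sum_down[OF fin, of "Suc j" f] f by (simp add: g_def sum_divide_distrib[symmetric])
  define h where "h A = f A - sum g A" for A
  have f_eq: "f A = sum g A + h A" for A by (simp add: h_def)
  have dh: "down V (Suc j) h v = 0" if "v \<in> V" for v
  proof -
    have "down V (Suc j) h v = down V (Suc j) f v - down V (Suc j) (\<lambda>A. sum g A) v"
      by (simp add: down_def h_def algebra_simps sum_subtractf)
    then show ?thesis using down_lift[OF fin g0 that, of j] c by (simp add: g_def c_def)
  qed
  have norm: "(\<Sum>A\<in>?W. (f A)\<^sup>2) = c * (\<Sum>v\<in>V. (g v)\<^sup>2) + (\<Sum>A\<in>?W. (h A)\<^sup>2)"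
  proof -
    have "(\<Sum>A\<in>?W. (f A)\<^sup>2)
        = (\<Sum>A\<in>?W. (sum g A)\<^sup>2) + 2 * (\<Sum>A\<in>?W. sum g A * h A) + (\<Sum>A\<in>?W. (h A)\<^sup>2)"
      by (simp add: f_eq power2_sum sum.distrib sum_distrib_left[of 2] ac_simps)
    moreover have "(\<Sum>A\<in>?W. sum g A * h A) = 0"
      unfolding lift_down_adjoint[OF fin] using dh by simp
    ultimately show ?thesis using sum_lift_squared[OF fin g0, of j] by (simp add: c_def)
  qed
  have en: "energy V X Y (Suc j) f
      = 2 * c * (\<Sum>x\<in>X. \<Sum>y\<in>Y. (g x - g y)\<^sup>2) + energy V X Y (Suc j) h"
  proof -
    have "(\<Sum>A\<in>?W. (f A - f (swap x y A))\<^sup>2)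
        = 2 * c * (g x - g y)\<^sup>2 + (\<Sum>A\<in>?W. (h A - h (swap x y A))\<^sup>2)"
      if "x \<in> X" "y \<in> Y" for x y
    proof -
      have xV: "x \<in> V" and yV: "y \<in> V" and ne: "x \<noteq> y" using that X Y disj by auto
      let ?d = "\<lambda>A. of_bool (x \<in> A) - of_bool (y \<in> A) :: real"
      have df: "f A - f (swap x y A) = (g x - g y) * ?d A + (h A - h (swap x y A))" if "A \<in> ?W" for A
      proof -
        have "finite A" using that fin by (auto simp: ksubsets_def dest: finite_subset)
        then show ?thesis using sum_minus_sum_swap[of A g x y] by (simp add: f_eq)
      qed
      have "(\<Sum>A\<in>?W. (f A - f (swap x y A))\<^sup>2)
          = (\<Sum>A\<in>?W. ((g x - g y) * ?d A + (h A - h (swap x y A)))\<^sup>2)"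
        using df by (intro sum.cong) auto
      also have "\<dots> = (g x - g y)\<^sup>2 * (\<Sum>A\<in>?W. (?d A)\<^sup>2)
          + 2 * (g x - g y) * (\<Sum>A\<in>?W. ?d A * (h A - h (swap x y A)))
          + (\<Sum>A\<in>?W. (h A - h (swap x y A))\<^sup>2)"
        unfolding power2_sum sum.distrib sum_distrib_left power_mult_distrib
        by (simp only: ac_simps)
      \<comment> \<open>The square is 1 exactly on the sets separating \<open>x\<close> from
        \<open>y\<close>; there are \<open>c\<close> of them for each choice of the contained
        vertex.\<close>
      also have "(\<Sum>A\<in>?W. (?d A)\<^sup>2) = 2 * c"
      proof -
        have "(\<Sum>A\<in>?W. (?d A)\<^sup>2) = (\<Sum>A\<in>?W. of_bool (x \<in> A) * (1 - of_bool (y \<in> A)))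
            + (\<Sum>A\<in>?W. of_bool (y \<in> A) * (1 - of_bool (x \<in> A)))"
          unfolding sum.distrib[symmetric] by (intro sum.cong) auto
        then show ?thesis
          using separating_ksubsets_count[OF fin xV yV ne, of j]
            separating_ksubsets_count[OF fin yV xV ne[symmetric], of j]
          by (simp add: c_def)
      qed
      \<comment> \<open>Pairing \<open>?d\<close> with \<open>h\<close> gives the difference of
        \<open>down\<close> of \<open>h\<close> at \<open>x\<close> and \<open>y\<close>, which is
        0. The swapped term follows by reindexing, because the swap changes the sign of
        \<open>?d\<close>.\<close>
      also have "(\<Sum>A\<in>?W. ?d A * (h A - h (swap x y A))) = 0"
      proof -
        have dz: "(\<Sum>A\<in>?W. ?d A * h A) = 0"
          using dh[OF xV] dh[OF yV] by (simp add: down_def algebra_simps sum_subtractf)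
        have "(\<Sum>A\<in>?W. ?d A * h (swap x y A)) = (\<Sum>A\<in>?W. ?d (swap x y A) * h (swap x y (swap x y A)))"
          by (rule sum_ksubsets_swap[OF xV yV, symmetric])
        also have "\<dots> = - (\<Sum>A\<in>?W. ?d A * h A)"
          unfolding swap_swap mem_swap sum_negf[symmetric] by (simp add: algebra_simps)
        finally show ?thesis using dz by (simp add: right_diff_distrib sum_subtractf)
      qed
      finally show ?thesis by simp
    qed
    then show ?thesis by (simp add: energy_def sum.distrib sum_distrib_left)
  qed
  have "2 * c * (m * (\<Sum>v\<in>V. (g v)\<^sup>2)) \<le> 2 * c * (\<Sum>x\<in>X. \<Sum>y\<in>Y. (g x - g y)\<^sup>2)"
    using D[OF g0] c by (intro mult_left_mono) auto
  moreover have "2 * m * (\<Sum>A\<in>?W. (f A)\<^sup>2)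
      = 2 * c * (m * (\<Sum>v\<in>V. (g v)\<^sup>2)) + 2 * m * (\<Sum>A\<in>?W. (h A)\<^sup>2)"
    unfolding norm by (simp only: distrib_left ac_simps)
  moreover have "2 * m * (\<Sum>A\<in>?W. (h A)\<^sup>2) \<le> energy V X Y (Suc j) h"
    by (rule H) (rule dh)
  ultimately show ?thesis unfolding en by linarith
qed

section \<open>The spectral gap for complete bipartite graphs\<close>

text \<open>No swap moves \<open>v\<close>, so sets containing \<open>v\<close> and sets avoiding it
  never interact.\<close>

lemma energy_remove_vertex:
  assumes fin: "finite V" and v: "v \<in> V" "v \<notin> X" "v \<notin> Y"
  shows "energy V X Y (Suc j) h
    = energy (V - {v}) X Y (Suc j) h + energy (V - {v}) X Y j (\<lambda>A. h (insert v A))"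
proof -
  have "(\<Sum>A\<in>ksubsets V (Suc j). (h A - h (swap x y A))\<^sup>2)
      = (\<Sum>A\<in>ksubsets (V - {v}) (Suc j). (h A - h (swap x y A))\<^sup>2)
      + (\<Sum>A\<in>ksubsets (V - {v}) j. (h (insert v A) - h (insert v (swap x y A)))\<^sup>2)"
    if "x \<in> X" "y \<in> Y" for x y
  proof -
    have "v \<noteq> x" "v \<noteq> y" using that v by auto
    then have "swap x y (insert v A) = insert v (swap x y A)" for A by simp
    then show ?thesis by (simp only: sum_ksubsets_remove[OF fin v(1)])
  qed
  then show ?thesis by (simp add: energy_def sum.distrib)
qed

lemma sum_energy_remove_vertex:
  assumes "finite X"
  shows "(\<Sum>v\<in>X. energy V (X - {v}) Y k h) = (real (card X) - 1) * energy V X Y k h"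
proof -
  let ?F = "\<lambda>x. \<Sum>y\<in>Y. \<Sum>A\<in>ksubsets V k. (h A - h (swap x y A))\<^sup>2"
  have "(\<Sum>v\<in>X. energy V (X - {v}) Y k h) = (\<Sum>v\<in>X. sum ?F X - ?F v)"
    unfolding energy_def using assms by (intro sum.cong) (auto simp: sum_diff1)
  also have "\<dots> = (real (card X) - 1) * sum ?F X"
    by (simp add: sum_subtractf algebra_simps)
  finally show ?thesis by (simp add: energy_def)
qed

text \<open>Each pair \<open>(x, y)\<close> survives \<open>card X - 1\<close> of the \<open>card X\<close> removals: averaging gains the factor
  \<open>card X / (card X - 1)\<close>, which compensates for the smaller gap of the smaller graphs.\<close>

lemma energy_gap_down_zero:
  assumes fin: "finite V" and XV: "X \<subseteq> V" and disj: "X \<inter> Y = {}"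
    and IH: "\<And>v k f. v \<in> X \<Longrightarrow> (\<Sum>A\<in>ksubsets (V - {v}) k. f A) = 0 \<Longrightarrow>
      m * (\<Sum>A\<in>ksubsets (V - {v}) k. (f A)\<^sup>2) \<le> energy (V - {v}) (X - {v}) Y k f"
    and h: "\<And>v. v \<in> V \<Longrightarrow> down V (Suc j) h v = 0"
  shows "real (card X) * m * (\<Sum>A\<in>ksubsets V (Suc j). (h A)\<^sup>2)
    \<le> (real (card X) - 1) * energy V X Y (Suc j) h"
proof -
  have finX: "finite X" using fin XV by (rule rev_finite_subset)
  have "real (Suc j) * (\<Sum>A\<in>ksubsets V (Suc j). h A) = 0"
    unfolding sum_down[OF fin, symmetric] using h by simp
  then have tot: "(\<Sum>A\<in>ksubsets V (Suc j). h A) = 0" by (simp only: mult_eq_0_iff) simp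
  have "m * (\<Sum>A\<in>ksubsets V (Suc j). (h A)\<^sup>2) \<le> energy V (X - {v}) Y (Suc j) h" if v: "v \<in> X" for v
  proof -
    have vV: "v \<in> V" and vY: "v \<notin> Y" using v XV disj by auto
    have "down V (Suc j) h v = (\<Sum>A\<in>ksubsets (V - {v}) (Suc j). 0)
        + (\<Sum>A\<in>ksubsets (V - {v}) j. h (insert v A))"
      unfolding down_def sum_ksubsets_remove[OF fin vV]
      by (intro arg_cong2[where f = "(+)"] sum.cong) (auto simp: ksubsets_def)
    then have s1: "(\<Sum>A\<in>ksubsets (V - {v}) j. h (insert v A)) = 0"
      using h[OF vV] by simp
    then have s2: "(\<Sum>A\<in>ksubsets (V - {v}) (Suc j). h A) = 0"
      using tot unfolding sum_ksubsets_remove[OF fin vV] by simp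
    \<comment> \<open>Once taken out of \<open>X\<close>, the vertex \<open>v\<close> is isolated,
      so the energy splits and \<open>IH\<close> applies to both restrictions.\<close>
    have "energy V (X - {v}) Y (Suc j) h = energy (V - {v}) (X - {v}) Y (Suc j) h
        + energy (V - {v}) (X - {v}) Y j (\<lambda>A. h (insert v A))"
      using energy_remove_vertex[OF fin vV] vY by simp
    then show ?thesis
      using IH[OF v s1] IH[OF v s2] by (simp add: sum_ksubsets_remove[OF fin vV] algebra_simps)
  qed
  then have "(\<Sum>v\<in>X. m * (\<Sum>A\<in>ksubsets V (Suc j). (h A)\<^sup>2))
      \<le> (\<Sum>v\<in>X. energy V (X - {v}) Y (Suc j) h)"
    by (rule sum_mono)
  then show ?thesis by (simp add: sum_energy_remove_vertex[OF finX])
qed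

lemma bipartite_form_ge:
  fixes g :: "'v \<Rightarrow> real"
  assumes fin: "finite X" "finite Y" and disj: "X \<inter> Y = {}" and le: "card X \<le> card Y"
    and g: "sum g (X \<union> Y) = 0"
  shows "real (card X) * (\<Sum>v\<in>X \<union> Y. (g v)\<^sup>2) \<le> (\<Sum>x\<in>X. \<Sum>y\<in>Y. (g x - g y)\<^sup>2)"
proof -
  have s: "sum g Y = - sum g X" using g by (simp add: sum.union_disjoint[OF fin disj])
  have "(\<Sum>x\<in>X. \<Sum>y\<in>Y. (g x - g y)\<^sup>2)
      = (\<Sum>x\<in>X. real (card Y) * (g x)\<^sup>2 + (\<Sum>y\<in>Y. (g y)\<^sup>2) - 2 * g x * sum g Y)"
    by (simp add: power2_diff sum.distrib sum_subtractf sum_distrib_left)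
  also have "\<dots> = real (card Y) * (\<Sum>x\<in>X. (g x)\<^sup>2) + real (card X) * (\<Sum>y\<in>Y. (g y)\<^sup>2)
      - 2 * sum g X * sum g Y"
    by (simp add: sum.distrib sum_subtractf sum_distrib_left[symmetric] sum_distrib_right[symmetric])
  also have "\<dots> = real (card Y) * (\<Sum>x\<in>X. (g x)\<^sup>2) + real (card X) * (\<Sum>y\<in>Y. (g y)\<^sup>2)
      + 2 * (sum g X)\<^sup>2"
    by (simp add: s power2_eq_square)
  finally have "(\<Sum>x\<in>X. \<Sum>y\<in>Y. (g x - g y)\<^sup>2) = real (card Y) * (\<Sum>x\<in>X. (g x)\<^sup>2)
      + real (card X) * (\<Sum>y\<in>Y. (g y)\<^sup>2) + 2 * (sum g X)\<^sup>2" .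
  moreover have "real (card X) * (\<Sum>x\<in>X. (g x)\<^sup>2) \<le> real (card Y) * (\<Sum>x\<in>X. (g x)\<^sup>2)"
    using le by (intro mult_right_mono) (auto intro: sum_nonneg)
  moreover have "0 \<le> (sum g X)\<^sup>2" by simp
  ultimately show ?thesis unfolding sum.union_disjoint[OF fin disj] distrib_left by linarith
qed

section \<open>Base cases and induction on the number of vertices\<close>

lemma sum_ksubsets_square_trivial:
  fixes f :: "'v set \<Rightarrow> real"
  assumes fin: "finite V" and k: "k = 0 \<or> card V \<le> k" and f: "(\<Sum>A\<in>ksubsets V k. f A) = 0"
  shows "(\<Sum>A\<in>ksubsets V k. (f A)\<^sup>2) = 0"
proof -
  \<comment> \<open>There is at most one such subset, so mean zero forces \<open>f\<close> to vanish
    on it.\<close>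
  have "A = (if k = 0 then {} else V)" if "A \<in> ksubsets V k" for A
  proof -
    have A: "A \<subseteq> V" "card A = k" using that by (auto simp: ksubsets_def)
    then have "finite A" using fin finite_subset by blast
    then show ?thesis using A k card_seteq[OF fin A(1)] by (cases "k = 0") auto
  qed
  then have "ksubsets V k = {} \<or> (\<exists>A. ksubsets V k = {A})" by blast
  then show ?thesis using f by auto
qed

text \<open>The two values of \<open>f\<close> are opposite, and equality holds. The constant is
  \<open>2 * 2\<close>, since a single edge has gap 2; this is stronger than the general
  bound.\<close>

lemma energy_gap_edge:
  assumes xy: "x \<noteq> y" and f: "(\<Sum>A\<in>ksubsets {x, y} 1. f A) = 0"
  shows "4 * (\<Sum>A\<in>ksubsets {x, y} 1. (f A)\<^sup>2) \<le> energy {x, y} {x} {y} 1 f"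
proof -
  have W: "ksubsets {x, y} 1 = {{x}, {y}}" by (auto simp: ksubsets_def card_1_singleton_iff)
  have "f {y} = - f {x}" using f xy unfolding W by simp
  then show ?thesis using xy unfolding energy_def W by (simp add: power2_eq_square)
qed

lemma energy_gap:
  fixes X Y :: "'v set" and f :: "'v set \<Rightarrow> real"
  assumes "finite X" "finite Y" "X \<inter> Y = {}" "card X \<le> card Y"
    and "(\<Sum>A\<in>ksubsets (X \<union> Y) k. f A) = 0"
  shows "2 * real (card X) * (\<Sum>A\<in>ksubsets (X \<union> Y) k. (f A)\<^sup>2) \<le> energy (X \<union> Y) X Y k f"
  using assms
proof (induction "card X + card Y" arbitrary: X Y k f rule: less_induct)
  case less
  let ?V = "X \<union> Y"
  note fX = less.prems(1) and fY = less.prems(2) and disj = less.prems(3) and le = less.prems(4)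
  have fin: "finite ?V" using fX fY by simp
  have cV: "card ?V = card X + card Y" using fX fY disj by (rule card_Un_disjoint)
  \<comment> \<open>For a single edge the averaging factor \<open>card X - 1\<close> is 0, so it is
    a base case; otherwise one side offers at least two vertices to average over.\<close>
  consider "card X = 0" | "k = 0 \<or> card ?V \<le> k" | "card X = 1" "card Y = 1" "k = 1"
    | "card X > 0" "k \<noteq> 0" "k < card ?V" "card X \<ge> 2 \<or> card Y \<ge> 2"
    using le cV by linarith
  then show ?case
  proof cases
    case 1
    then show ?thesis using energy_nonneg[of ?V X Y k f] by simp
  next
    case 2
    then show ?thesis
      using sum_ksubsets_square_trivial[OF fin _ less.prems(5)] energy_nonneg[of ?V X Y k f] by simp
  next
    case 3
    then obtain x y where xy: "X = {x}" "Y = {y}" by (auto simp: card_1_singleton_iff)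
    have "0 \<le> (\<Sum>A\<in>ksubsets {x, y} 1. (f A)\<^sup>2)" by (rule sum_nonneg) simp
    then show ?thesis
      using energy_gap_edge[of x y f] less.prems(3,5) 3 xy by (simp add: insert_commute)
  next
    case 4
    then obtain j where j: "k = Suc j" using not0_implies_Suc by blast
    show ?thesis
      unfolding j
    proof (rule energy_gap_of_orthogonal_parts[OF fin _ _ disj])
      show "Suc j < card ?V" using 4 j by simp
      show "real (card X) * (\<Sum>v\<in>?V. (g v)\<^sup>2) \<le> (\<Sum>x\<in>X. \<Sum>y\<in>Y. (g x - g y)\<^sup>2)"
        if "sum g ?V = 0" for g
        using bipartite_form_ge[OF fX fY disj le that] .
      show "(\<Sum>A\<in>ksubsets ?V (Suc j). f A) = 0" using less.prems(5) j by simp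
      fix h assume h: "\<And>v. v \<in> ?V \<Longrightarrow> down ?V (Suc j) h v = 0"
      let ?S = "\<Sum>A\<in>ksubsets ?V (Suc j). (h A)\<^sup>2"
      have S: "?S \<ge> 0" by (rule sum_nonneg) simp
      show "2 * real (card X) * ?S \<le> energy ?V X Y (Suc j) h"
      proof (cases "card X \<ge> 2")
        case True
        \<comment> \<open>The smaller graphs give the constant \<open>2 * (card X - 1)\<close>, and
          averaging raises it to exactly \<open>2 * card X\<close>.\<close>
        have "real (card X) * (2 * (real (card X) - 1)) * ?S
            \<le> (real (card X) - 1) * energy ?V X Y (Suc j) h"
        proof (rule energy_gap_down_zero[OF fin _ disj _ h])
          fix v k and f :: "'v set \<Rightarrow> real"
          assume v: "v \<in> X" and f: "(\<Sum>A\<in>ksubsets (?V - {v}) k. f A) = 0"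
          have eq: "?V - {v} = (X - {v}) \<union> Y" using v disj by auto
          have c: "card (X - {v}) = card X - 1" using v fX by simp
          have "2 * real (card (X - {v})) * (\<Sum>A\<in>ksubsets ((X - {v}) \<union> Y) k. (f A)\<^sup>2)
              \<le> energy ((X - {v}) \<union> Y) (X - {v}) Y k f"
            using f fX fY disj le c True by (intro less.hyps) (auto simp: eq)
          then show "2 * (real (card X) - 1) * (\<Sum>A\<in>ksubsets (?V - {v}) k. (f A)\<^sup>2)
              \<le> energy (?V - {v}) (X - {v}) Y k f"
            unfolding eq c using True by (simp add: of_nat_diff)
        qed auto
        then have "(real (card X) - 1) * (2 * real (card X) * ?S)
            \<le> (real (card X) - 1) * energy ?V X Y (Suc j) h"
          by (simp only: ac_simps)
        then show ?thesis using True by (subst (asm) mult_le_cancel_left_pos) auto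
      next
        case False
        then have X1: "card X = 1" and Y2: "card Y \<ge> 2" using 4 by auto
        \<comment> \<open>In a star, deleting the centre would destroy all edges, so the leaves are
          removed instead. The smaller stars keep the constant 2, and the factor
          \<open>card Y / (card Y - 1)\<close> leaves room to spare.\<close>
        have "real (card Y) * 2 * ?S \<le> (real (card Y) - 1) * energy ?V Y X (Suc j) h"
        proof (rule energy_gap_down_zero[OF fin _ _ _ h])
          show "Y \<inter> X = {}" using disj by blast
          fix v k and f :: "'v set \<Rightarrow> real"
          assume v: "v \<in> Y" and f: "(\<Sum>A\<in>ksubsets (?V - {v}) k. f A) = 0"
          have eq: "?V - {v} = X \<union> (Y - {v})" using v disj by auto
          have c: "card (Y - {v}) = card Y - 1" using v fY by simp
          have "2 * real (card X) * (\<Sum>A\<in>ksubsets (X \<union> (Y - {v})) k. (f A)\<^sup>2)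
              \<le> energy (X \<union> (Y - {v})) X (Y - {v}) k f"
            using f fX fY disj c X1 Y2 by (intro less.hyps) (auto simp: eq)
          then show "2 * (\<Sum>A\<in>ksubsets (?V - {v}) k. (f A)\<^sup>2)
              \<le> energy (?V - {v}) (Y - {v}) X k f"
            unfolding eq using X1 energy_commute[of _ X] by simp
        qed auto
        moreover have "(real (card Y) - 1) * (2 * ?S) \<le> real (card Y) * 2 * ?S"
          using S by (simp add: algebra_simps)
        ultimately have "(real (card Y) - 1) * (2 * ?S)
            \<le> (real (card Y) - 1) * energy ?V X Y (Suc j) h"
          using energy_commute[of ?V X] by simp
        then show ?thesis using X1 Y2 by (subst (asm) mult_le_cancel_left_pos) auto
      qed
    qed auto
  qed
qed

section \<open>Token graphs\<close>

lemma verts_token_graph: "verts (token_graph k G) = ksubsets (verts G) k"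
  by (simp add: token_graph_def Let_def ksubsets_def)

lemma edges_token_graph:
  "{A, B} \<in> edges (token_graph k G) \<longleftrightarrow>
    A \<in> ksubsets (verts G) k \<and> B \<in> ksubsets (verts G) k \<and> sym_diff A B \<in> edges G"
  by (auto simp: token_graph_def Let_def ksubsets_def doubleton_eq_iff Un_commute)

lemma token_graph_simple:
  assumes "\<forall>e\<in>edges G. e \<subseteq> verts G \<and> card e = 2"
  shows "\<forall>e\<in>edges (token_graph k G). e \<subseteq> verts (token_graph k G) \<and> card e = 2"
proof
  fix e assume e: "e \<in> edges (token_graph k G)"
  then obtain A B where AB: "e = {A, B}" by (auto simp: token_graph_def Let_def)
  have "{} \<notin> edges G" using assms by force
  then have "A \<noteq> B" using e unfolding AB edges_token_graph by auto
  then show "e \<subseteq> verts (token_graph k G) \<and> card e = 2"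
    using e unfolding AB edges_token_graph verts_token_graph by auto
qed

text \<open>A neighbour of \<open>A\<close> arises by moving one token from an occupied
  \<open>a\<close> to a free \<open>b\<close>, and the ordered pair can be recovered from the
  result.\<close>

lemma sum_token_neighbours:
  assumes fin: "finite (verts G)" and simple: "\<forall>e\<in>edges G. e \<subseteq> verts G \<and> card e = 2"
    and A: "A \<in> ksubsets (verts G) k"
  shows "(\<Sum>B | B \<in> verts (token_graph k G) \<and> {A, B} \<in> edges (token_graph k G). F B)
    = (\<Sum>(a, b) | a \<in> A \<and> b \<in> verts G - A \<and> {a, b} \<in> edges G. F (swap a b A))"
proof -
  let ?P = "{(a, b). a \<in> A \<and> b \<in> verts G - A \<and> {a, b} \<in> edges G}"
  let ?N = "{B. B \<in> verts (token_graph k G) \<and> {A, B} \<in> edges (token_graph k G)}"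
  have finA: "finite A" and AV: "A \<subseteq> verts G"
    using A fin by (auto simp: ksubsets_def dest: finite_subset)
  have sw: "swap a b A = insert b (A - {a})" if "a \<in> A" "b \<notin> A" for a b
    using that by (auto simp: Transposition.transpose_def image_iff)
  have "bij_betw (\<lambda>(a, b). swap a b A) ?P ?N"
    unfolding bij_betw_def
  proof
    show "inj_on (\<lambda>(a, b). swap a b A) ?P"
    proof (rule inj_onI, clarify)
      fix a b a' b'
      assume ab: "a \<in> A" "b \<notin> A" "a' \<in> A" "b' \<notin> A" and "swap a b A = swap a' b' A"
      then have eq: "insert b (A - {a}) = insert b' (A - {a'})" by (simp add: sw)
      have "a \<notin> insert b (A - {a})" using ab by auto
      then have "a = a'" using ab unfolding eq by auto
      moreover have "b \<in> insert b' (A - {a'})" unfolding eq[symmetric] by simp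
      ultimately show "a = a' \<and> b = b'" using ab by auto
    qed
    show "(\<lambda>(a, b). swap a b A) ` ?P = ?N"
    proof (intro equalityI subsetI)
      fix B assume "B \<in> (\<lambda>(a, b). swap a b A) ` ?P"
      then obtain a b where ab: "a \<in> A" "b \<in> verts G" "b \<notin> A" "{a, b} \<in> edges G" "B = swap a b A"
        by auto
      have "sym_diff A B = {a, b}" using ab(1,3) unfolding ab(5) sw[OF ab(1,3)] by auto
      then show "B \<in> ?N"
        using ab A AV swap_mem_ksubsets[of a "verts G" b A k]
        by (auto simp: edges_token_graph verts_token_graph)
    next
      fix B assume "B \<in> ?N"
      then have B: "B \<in> ksubsets (verts G) k" and e: "sym_diff A B \<in> edges G"
        by (auto simp: edges_token_graph)
      have finB: "finite B" using B fin by (auto simp: ksubsets_def dest: finite_subset)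
      \<comment> \<open>Sets of equal size with a two-element symmetric difference each have one
        private element.\<close>
      have "card (sym_diff A B) = 2" using e simple by blast
      then have "card (A - B) + card (B - A) = 2"
        using finA finB by (subst (asm) card_Un_disjoint) auto
      moreover have "card (A - B) = card (B - A)"
        using A B finA finB by (intro card_le_sym_Diff antisym) (auto simp: ksubsets_def card_le_sym_Diff)
      ultimately have "card (A - B) = 1" "card (B - A) = 1" by auto
      then obtain a b where ab: "A - B = {a}" "B - A = {b}" by (auto simp: card_1_singleton_iff)
      then have "sym_diff A B = {a, b}" "a \<in> A" "b \<notin> A" "b \<in> B" by auto
      moreover have "B = insert b (A - {a})" using ab by blast
      ultimately show "B \<in> (\<lambda>(a, b). swap a b A) ` ?P"
        using e B by (intro image_eqI[of _ _ "(a, b)"]) (auto simp: sw ksubsets_def)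
    qed
  qed
  then show ?thesis
    by (subst sum.reindex_bij_betw[symmetric]) (auto simp: case_prod_unfold)
qed

section \<open>Lifted eigenfunctions and comparison with the bipartite forms\<close>

lemma token_lift_eigenfunction:
  fixes g :: "'v \<Rightarrow> real"
  assumes fin: "finite (verts G)" and simple: "\<forall>e\<in>edges G. e \<subseteq> verts G \<and> card e = 2"
    and g: "\<And>u. u \<in> verts G \<Longrightarrow> (\<Sum>v | v \<in> verts G \<and> {u, v} \<in> edges G. g u - g v) = c * g u"
    and A: "A \<in> ksubsets (verts G) k"
  shows "(\<Sum>B | B \<in> verts (token_graph k G) \<and> {A, B} \<in> edges (token_graph k G). sum g A - sum g B)
    = c * sum g A"
proof -
  have finA: "finite A" and AV: "A \<subseteq> verts G"
    using A fin by (auto simp: ksubsets_def dest: finite_subset)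
  let ?I = "\<lambda>a. {b \<in> A. {a, b} \<in> edges G}" and ?O = "\<lambda>a. {b \<in> verts G - A. {a, b} \<in> edges G}"
  have "(\<Sum>B | B \<in> verts (token_graph k G) \<and> {A, B} \<in> edges (token_graph k G). sum g A - sum g B)
      = (\<Sum>(a, b) | a \<in> A \<and> b \<in> verts G - A \<and> {a, b} \<in> edges G. sum g A - sum g (swap a b A))"
    by (rule sum_token_neighbours[OF fin simple A])
  also have "\<dots> = (\<Sum>(a, b) | a \<in> A \<and> b \<in> verts G - A \<and> {a, b} \<in> edges G. g a - g b)"
    using sum_minus_sum_swap[OF finA, of g] by (intro sum.cong) auto
  also have "\<dots> = (\<Sum>a\<in>A. \<Sum>b\<in>?O a. g a - g b)"
    using fin finA by (subst sum.Sigma) (auto intro!: sum.cong)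
  \<comment> \<open>Edges inside \<open>A\<close> contribute 0 in total by antisymmetry; adding them
    completes the neighbour sum at every \<open>a\<close>.\<close>
  also have "\<dots> = (\<Sum>a\<in>A. \<Sum>b\<in>?O a. g a - g b) + (\<Sum>a\<in>A. \<Sum>b\<in>?I a. g a - g b)"
  proof -
    have "(\<Sum>a\<in>A. \<Sum>b\<in>?I a. g a - g b) = (\<Sum>a\<in>A. \<Sum>b\<in>?I a. g b - g a)"
      by (rule sum_neighbours_commute[OF finA])
    also have "\<dots> = - (\<Sum>a\<in>A. \<Sum>b\<in>?I a. g a - g b)"
      by (simp add: sum_negf[symmetric])
    finally show ?thesis by simp
  qed
  also have "\<dots> = (\<Sum>a\<in>A. \<Sum>v | v \<in> verts G \<and> {a, v} \<in> edges G. g a - g v)"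
    unfolding sum.distrib[symmetric]
  proof (rule sum.cong[OF refl])
    fix a assume "a \<in> A"
    have "{v. v \<in> verts G \<and> {a, v} \<in> edges G} = ?O a \<union> ?I a" using AV by auto
    then show "(\<Sum>b\<in>?O a. g a - g b) + (\<Sum>b\<in>?I a. g a - g b)
        = (\<Sum>v | v \<in> verts G \<and> {a, v} \<in> edges G. g a - g v)"
      using fin finA by (simp only:) (subst sum.union_disjoint, auto)
  qed
  also have "\<dots> = c * sum g A"
    using g AV by (simp add: sum_distrib_left subset_iff)
  finally show ?thesis .
qed

text \<open>Each pair separated by \<open>A\<close> is a token move along an edge of
  \<open>G\<close>, while a pair not separated by \<open>A\<close> contributes 0. Further edges only
  add squares.\<close>

lemma energy_le_token_dirichlet:
  assumes fin: "finite (verts G)" and simple: "\<forall>e\<in>edges G. e \<subseteq> verts G \<and> card e = 2"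
    and X: "X \<subseteq> verts G" and Y: "Y \<subseteq> verts G" and disj: "X \<inter> Y = {}"
    and E: "\<forall>x\<in>X. \<forall>y\<in>Y. {x, y} \<in> edges G"
  shows "energy (verts G) X Y k f \<le> (\<Sum>A\<in>verts (token_graph k G).
    \<Sum>B | B \<in> verts (token_graph k G) \<and> {A, B} \<in> edges (token_graph k G). (f A - f B)\<^sup>2)"
proof -
  let ?W = "ksubsets (verts G) k"
  have finX: "finite X" and finY: "finite Y" using fin X Y by (auto dest: finite_subset)
  have "energy (verts G) X Y k f = (\<Sum>x\<in>X. \<Sum>A\<in>?W. \<Sum>y\<in>Y. (f A - f (swap x y A))\<^sup>2)"
    unfolding energy_def by (intro sum.cong refl sum.swap)
  also have "\<dots> = (\<Sum>A\<in>?W. \<Sum>x\<in>X. \<Sum>y\<in>Y. (f A - f (swap x y A))\<^sup>2)"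
    by (rule sum.swap)
  also have "\<dots> = (\<Sum>A\<in>?W. \<Sum>(x, y)\<in>X \<times> Y. (f A - f (swap x y A))\<^sup>2)"
    by (intro sum.cong refl sum.cartesian_product)
  also have "\<dots> \<le> (\<Sum>A\<in>?W. \<Sum>B | B \<in> verts (token_graph k G) \<and> {A, B} \<in> edges (token_graph k G).
      (f A - f B)\<^sup>2)"
  proof (rule sum_mono)
    fix A assume A: "A \<in> ?W"
    have finA: "finite A" using A fin by (auto simp: ksubsets_def dest: finite_subset)
    let ?T = "\<lambda>(x, y). (f A - f (swap x y A))\<^sup>2"
    let ?Q = "{p \<in> X \<times> Y. (fst p \<in> A) \<noteq> (snd p \<in> A)}"
    let ?P = "{(a, b). a \<in> A \<and> b \<in> verts G - A \<and> {a, b} \<in> edges G}"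
    \<comment> \<open>Orients a pair from the occupied to the free vertex; this is injective because
      \<open>X\<close> and \<open>Y\<close> are disjoint.\<close>
    define \<phi> where "\<phi> p = (if fst p \<in> A then p else (snd p, fst p))" for p
    have "?T p = 0" if "fst p \<in> A \<longleftrightarrow> snd p \<in> A" for p using that by (cases p) simp
    then have "sum ?T (X \<times> Y) = sum ?T ?Q"
      using finX finY by (intro sum.mono_neutral_right) (auto simp del: split_paired_All)
    also have "\<dots> = sum (?T \<circ> \<phi>) ?Q"
      by (intro sum.cong) (auto simp: \<phi>_def transpose_commute)
    also have "\<dots> = sum ?T (\<phi> ` ?Q)"
      using disj by (intro sum.reindex[symmetric] inj_onI) (auto simp: \<phi>_def split: if_splits)
    also have "\<dots> \<le> sum ?T ?P"
    proof (rule sum_mono2)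
      show "finite ?P" using finA fin by (auto intro: finite_subset[of _ "A \<times> verts G"])
      show "\<phi> ` ?Q \<subseteq> ?P" using X Y E by (auto simp: \<phi>_def insert_commute)
    qed auto
    also have "\<dots> = (\<Sum>B | B \<in> verts (token_graph k G) \<and> {A, B} \<in> edges (token_graph k G). (f A - f B)\<^sup>2)"
      by (rule sum_token_neighbours[OF fin simple A, symmetric])
    finally show "sum ?T (X \<times> Y)
      \<le> (\<Sum>B | B \<in> verts (token_graph k G) \<and> {A, B} \<in> edges (token_graph k G). (f A - f B)\<^sup>2)" .
  qed
  finally show ?thesis by (simp add: verts_token_graph)
qed

text \<open>Every pair of \<open>X \<times> Y\<close> occurs on the right in both orders, hence the
  factor 2.\<close>

lemma bipartite_form_le_dirichlet:
  fixes f :: "'v \<Rightarrow> real"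
  assumes fin: "finite V" and X: "X \<subseteq> V" and Y: "Y \<subseteq> V" and disj: "X \<inter> Y = {}"
    and E: "\<forall>x\<in>X. \<forall>y\<in>Y. {x, y} \<in> E"
  shows "2 * (\<Sum>x\<in>X. \<Sum>y\<in>Y. (f x - f y)\<^sup>2) \<le> (\<Sum>u\<in>V. \<Sum>v | v \<in> V \<and> {u, v} \<in> E. (f u - f v)\<^sup>2)"
proof -
  let ?T = "\<lambda>(u, v). (f u - f v)\<^sup>2"
  have finX: "finite X" and finY: "finite Y" using fin X Y by (auto dest: finite_subset)
  have "(\<Sum>x\<in>X. \<Sum>y\<in>Y. (f x - f y)\<^sup>2) = (\<Sum>y\<in>Y. \<Sum>x\<in>X. (f y - f x)\<^sup>2)"
    by (subst sum.swap) (simp add: power2_commute)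
  then have "2 * (\<Sum>x\<in>X. \<Sum>y\<in>Y. (f x - f y)\<^sup>2) = sum ?T (X \<times> Y) + sum ?T (Y \<times> X)"
    by (simp add: sum.cartesian_product)
  also have "\<dots> = sum ?T (X \<times> Y \<union> Y \<times> X)"
    using finX finY disj by (intro sum.union_disjoint[symmetric]) auto
  also have "\<dots> \<le> sum ?T (SIGMA u:V. {v \<in> V. {u, v} \<in> E})"
  proof (rule sum_mono2)
    have "{y, x} \<in> E" if "x \<in> X" "y \<in> Y" for x y using E that by (metis insert_commute)
    then show "X \<times> Y \<union> Y \<times> X \<subseteq> (SIGMA u:V. {v \<in> V. {u, v} \<in> E})" using X Y E by auto
  qed (use fin in auto)
  also have "\<dots> = (\<Sum>u\<in>V. \<Sum>v | v \<in> V \<and> {u, v} \<in> E. (f u - f v)\<^sup>2)"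
    using fin by (subst sum.Sigma) auto
  finally show ?thesis .
qed

text \<open>One eigenfunction \<open>g\<close> serves both graphs, through its lift for the token
  graph. The constant \<open>c\<close> stays free so that the single edge is covered too.\<close>

lemma algebraic_connectivity_token_graph:
  fixes G :: "'v graph" and g :: "'v \<Rightarrow> real"
  assumes fin: "finite (verts G)" and simple: "\<forall>e\<in>edges G. e \<subseteq> verts G \<and> card e = 2"
    and X: "X \<subseteq> verts G" and Y: "Y \<subseteq> verts G" and disj: "X \<inter> Y = {}"
    and E: "\<forall>x\<in>X. \<forall>y\<in>Y. {x, y} \<in> edges G"
    and k: "0 < k" "k < card (verts G)" and c: "c \<ge> 0"
    and g: "sum g (verts G) = 0" "\<exists>v\<in>verts G. g v \<noteq> 0"
      "\<And>u. u \<in> verts G \<Longrightarrow> (\<Sum>v | v \<in> verts G \<and> {u, v} \<in> edges G. g u - g v) = c * g u"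
    and form: "\<And>f. sum f (verts G) = 0 \<Longrightarrow>
      c * (\<Sum>v\<in>verts G. (f v)\<^sup>2) \<le> (\<Sum>x\<in>X. \<Sum>y\<in>Y. (f x - f y)\<^sup>2)"
    and energy: "\<And>f. (\<Sum>A\<in>ksubsets (verts G) k. f A) = 0 \<Longrightarrow>
      2 * c * (\<Sum>A\<in>ksubsets (verts G) k. (f A)\<^sup>2) \<le> energy (verts G) X Y k f"
  shows "algebraic_connectivity G = c" and "algebraic_connectivity (token_graph k G) = c"
proof -
  show "algebraic_connectivity G = c"
  proof (rule algebraic_connectivity_eqI[OF fin simple _ g c])
    fix f :: "'v \<Rightarrow> real" assume "sum f (verts G) = 0"
    then show "2 * c * (\<Sum>v\<in>verts G. (f v)\<^sup>2)
        \<le> (\<Sum>u\<in>verts G. \<Sum>v | v \<in> verts G \<and> {u, v} \<in> edges G. (f u - f v)\<^sup>2)"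
      using form[of f] bipartite_form_le_dirichlet[OF fin X Y disj E, of f] by simp
  qed
  obtain j where j: "k = Suc j" using k(1) gr0_implies_Suc by blast
  show "algebraic_connectivity (token_graph k G) = c"
  proof (rule algebraic_connectivity_eqI[OF _ token_graph_simple[OF simple] _ _ _ _ c])
    show "finite (verts (token_graph k G))" by (simp add: verts_token_graph finite_ksubsets fin)
    show "(\<Sum>A\<in>verts (token_graph k G). sum g A) = 0"
      unfolding verts_token_graph j by (rule sum_lift_eq_0[OF fin g(1)])
    \<comment> \<open>The squared norm of the lift is that of \<open>g\<close> times a binomial
      coefficient, which is positive because \<open>k < card (verts G)\<close>.\<close>
    show "\<exists>A\<in>verts (token_graph k G). sum g A \<noteq> 0"
    proof (rule ccontr)
      assume "\<not> ?thesis"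
      then have "(\<Sum>A\<in>ksubsets (verts G) (Suc j). (sum g A)\<^sup>2) = 0"
        by (simp add: verts_token_graph j)
      moreover have "(\<Sum>v\<in>verts G. (g v)\<^sup>2) > 0" using g(2) fin by (auto intro!: sum_pos2)
      ultimately show False using k j by (simp add: sum_lift_squared[OF fin g(1)])
    qed
    show "(\<Sum>B | B \<in> verts (token_graph k G) \<and> {A, B} \<in> edges (token_graph k G). sum g A - sum g B)
        = c * sum g A" if "A \<in> verts (token_graph k G)" for A
      using token_lift_eigenfunction[OF fin simple g(3)] that by (simp add: verts_token_graph)
    fix f :: "'v set \<Rightarrow> real" assume "sum f (verts (token_graph k G)) = 0"
    then show "2 * c * (\<Sum>A\<in>verts (token_graph k G). (f A)\<^sup>2) \<le> (\<Sum>A\<in>verts (token_graph k G).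
        \<Sum>B | B \<in> verts (token_graph k G) \<and> {A, B} \<in> edges (token_graph k G). (f A - f B)\<^sup>2)"
      using energy[of f] energy_le_token_dirichlet[OF fin simple X Y disj E, of k f]
      by (simp add: verts_token_graph)
  qed
qed

section \<open>Eigenfunctions of the complete bipartite graph with added edges\<close>

theorem theorem3p8:
  fixes X Y :: "'v set" and S :: "'v set set" and n n1 n2 t k :: nat
  assumes "finite X" and "finite Y" and "X \<inter> Y = {}"
    and "card X = n1" and "card Y = n2" and "n1 \<le> n2" and "n = n1 + n2"
    and "S \<subseteq> {e. e \<subseteq> X \<and> card e = 2}" and "card S = t" and "t \<le> n1 * (n1 - 1) div 2"
    and "k \<in> {1..n - 1}"
  shows "algebraic_connectivity (token_graph k (add_edges (complete_bipartite X Y) S))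
           = algebraic_connectivity (add_edges (complete_bipartite X Y) S)
       \<and> ((n1, n2) \<noteq> (1, 1) \<longrightarrow>
           algebraic_connectivity (add_edges (complete_bipartite X Y) S) = real n1)"
proof -
  define G where "G = add_edges (complete_bipartite X Y) S"
  have V: "verts G = X \<union> Y" and Ed: "edges G = {{x, y} | x y. x \<in> X \<and> y \<in> Y} \<union> S"
    by (simp_all add: G_def add_edges_def complete_bipartite_def)
  have fin: "finite (verts G)" using assms(1,2) V by simp
  have cV: "card (verts G) = n" using assms card_Un_disjoint V by metis
  have simple: "\<forall>e\<in>edges G. e \<subseteq> verts G \<and> card e = 2"
    using assms(3,8) unfolding V Ed by (auto simp: card_2_iff) blast
  have E: "\<forall>x\<in>X. \<forall>y\<in>Y. {x, y} \<in> edges G" using Ed by blast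
  have XV: "X \<subseteq> verts G" and YV: "Y \<subseteq> verts G" using V by auto
  have k: "0 < k" "k < card (verts G)" using assms(11) cV by auto
  note main = algebraic_connectivity_token_graph[OF fin simple XV YV assms(3) E k]
  show ?thesis
  \<comment> \<open>A single edge has algebraic connectivity 2 rather than \<open>n1\<close>; there
    \<open>k = 1\<close>, and the equality is proved with the constant 2.\<close>
  proof (cases "n1 = 1 \<and> n2 = 1")
    case True
    then obtain x y where xy: "X = {x}" "Y = {y}"
      using assms(4,5) by (auto simp: card_1_singleton_iff)
    have ne: "x \<noteq> y" using assms(3) xy by auto
    have V2: "verts G = {x, y}" using V xy by auto
    have "card e \<le> 1" if "e \<in> S" for e
      using that assms(8) xy card_mono[of "{x}" e] by auto
    then have "S = {}" using assms(8) by force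
    then have E2: "edges G = {{x, y}}" using Ed xy by auto
    have k1: "k = 1" using assms(7,11) True by auto
    define g where "g v = (if v = x then 1 else - 1 :: real)" for v
    have nb: "{v. v \<in> verts G \<and> {u, v} \<in> edges G} = {x, y} - {u}" if "u \<in> verts G" for u
      using that V2 E2 ne by (auto simp: doubleton_eq_iff)
    have g: "sum g (verts G) = 0" "\<exists>v\<in>verts G. g v \<noteq> 0"
      "\<And>u. u \<in> verts G \<Longrightarrow> (\<Sum>v | v \<in> verts G \<and> {u, v} \<in> edges G. g u - g v) = 2 * g u"
      using ne unfolding nb by (auto simp: g_def V2 insert_Diff_if)
    have form: "2 * (\<Sum>v\<in>verts G. (f v)\<^sup>2) \<le> (\<Sum>x\<in>X. \<Sum>y\<in>Y. (f x - f y)\<^sup>2)"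
      if "sum f (verts G) = 0" for f :: "'v \<Rightarrow> real"
    proof -
      have "f y = - f x" using that ne V2 by simp
      then show ?thesis using ne by (simp add: V2 xy power2_eq_square)
    qed
    have en: "2 * 2 * (\<Sum>A\<in>ksubsets (verts G) k. (f A)\<^sup>2) \<le> energy (verts G) X Y k f"
      if "(\<Sum>A\<in>ksubsets (verts G) k. f A) = 0" for f :: "'v set \<Rightarrow> real"
      using energy_gap_edge[OF ne, of f] that unfolding V2 xy k1 by simp
    show ?thesis using main[OF zero_le_numeral g form en] True by (simp add: G_def)
  next
    case False
    \<comment> \<open>The range of \<open>k\<close> forces \<open>n \<ge> 2\<close>. The case
      \<open>n1 = 0\<close> stays included: the graph then has no edges and the value is 0.\<close>
    then have "n2 \<ge> 2" using assms(6,7,11) by auto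
    then obtain y1 y2 where y: "y1 \<in> Y" "y2 \<in> Y" "y1 \<noteq> y2"
      using assms(2,5) by (metis card_le_Suc0_iff_eq not_less_eq_eq numeral_2_eq_2)
    define g where "g v = (if v = y1 then 1 else if v = y2 then - 1 else 0 :: real)" for v
    have sumg: "sum g Z = of_bool (y1 \<in> Z) - of_bool (y2 \<in> Z)" if "finite Z" for Z
    proof -
      have "sum g Z = (\<Sum>v\<in>Z. (if v = y1 then 1 else 0) - (if v = y2 then 1 else 0))"
        using y(3) by (intro sum.cong) (auto simp: g_def)
      then show ?thesis using that by (simp add: sum_subtractf)
    qed
    have yX: "y1 \<notin> X" "y2 \<notin> X" using y assms(3) by auto
    have gX: "g u = 0" if "u \<in> X" for u using that yX by (auto simp: g_def)
    have g0: "sum g (verts G) = 0" using y sumg[OF fin] V by simp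
    have gn: "\<exists>v\<in>verts G. g v \<noteq> 0" using y V by (auto simp: g_def)
    \<comment> \<open>A vertex of \<open>Y\<close> has neighbourhood \<open>X\<close>, where
      \<open>g\<close> is 0. A vertex of \<open>X\<close> sees both \<open>y1\<close> and
      \<open>y2\<close>, whose values cancel, and edges of \<open>S\<close> join zeros of
      \<open>g\<close>.\<close>
    have ge: "(\<Sum>v | v \<in> verts G \<and> {u, v} \<in> edges G. g u - g v) = real n1 * g u"
      if u: "u \<in> verts G" for u
    proof (cases "u \<in> Y")
      case True
      have "{u, v} \<in> edges G \<longleftrightarrow> v \<in> X" if "v \<in> verts G" for v
        using True assms(3,8) unfolding Ed by (auto simp: doubleton_eq_iff)
      then have "{v. v \<in> verts G \<and> {u, v} \<in> edges G} = X" using XV by auto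
      then show ?thesis using gX assms(4) by simp
    next
      case False
      then have uX: "u \<in> X" using u V by auto
      let ?N = "{v. v \<in> verts G \<and> {u, v} \<in> edges G}"
      have "y1 \<in> ?N" "y2 \<in> ?N" using y YV E uX by auto
      then have "sum g ?N = 0" using sumg[of ?N] fin by simp
      then show ?thesis using gX[OF uX] by (simp add: sum_negf)
    qed
    have form: "real n1 * (\<Sum>v\<in>verts G. (f v)\<^sup>2) \<le> (\<Sum>x\<in>X. \<Sum>y\<in>Y. (f x - f y)\<^sup>2)"
      if "sum f (verts G) = 0" for f :: "'v \<Rightarrow> real"
      using bipartite_form_ge[OF assms(1-3), of f] that assms(4-6) V by simp
    have en: "2 * real n1 * (\<Sum>A\<in>ksubsets (verts G) k. (f A)\<^sup>2) \<le> energy (verts G) X Y k f"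
      if "(\<Sum>A\<in>ksubsets (verts G) k. f A) = 0" for f :: "'v set \<Rightarrow> real"
      using energy_gap[OF assms(1-3), of f k] that assms(4-6) V by simp
    show ?thesis using main[OF of_nat_0_le_iff g0 gn ge form en] by (simp add: G_def)
  qed
qed

end
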